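(* Let $\mathbf T$ be the algebra generated by $T$ and $\tilde T$ (equivalently, by $A,A^*,\tilde A^*$), and let $\mathbf W=\mathrm{Span}\{\hat C_i^{-},\hat C_i^{+}:0\le i\le d-1\}$, which is a $\mathbf T$-module. The $\mathbf T$-module $\mathbf W$ is irreducible.
   Context: **Graph.** $\Gamma$ is a finite undirected connected graph without loops or multiple edges, with vertex set $X$, path-length distance $\partial$ and diameter $d\ge 3$; $\Gamma_i(y)=\{z\in X:\partial(y,z)=i\}$, $\Gamma(y)=\Gamma_1(y)$. $\Gamma$ is distance-regular: $p^h_{ij}=|\Gamma_i(y)\cap\Gamma_j(z)|$ depends only on $i,j$ and $h=\partial(y,z)$. Put $a_i=p^i_{1,i}$, $b_i=p^i_{1,i+1}$, $c_i=p^i_{1,i-1}$ ($b_d=c_0=0$), $k=b_0$. Complex matrices indexed by $X$ act on $\mathbf V=\mathbb C^X$ with inner product $\langle u,v\rangle=u^t\overline v$; $\hat y$ is the standard basis vector at $y$, $\hat Y=\sum_{y\in Y}\hat y$, $\mathbf j=\hat X$. $A_i$ is the $i$-th distance matrix, $A=A_1$, $\mathcal M$ is the algebra generated by $A$ (Bose–Mesner algebra), with primitive idempotents $E_0=|X|^{-1}J,E_1,\dots,E_d$ ($J$ all-ones) and $A=\sum_i\theta_iE_i$; $m_i=\operatorname{rank}E_i$. $\Gamma$ is $Q$-polynomial with respect to $E_0,\dots,E_d$: writing $E_i\circ E_j=|X|^{-1}\sum_h q^h_{ij}E_h$ (entrywise product), $q^h_{ij}=0$ (resp. $\ne0$) if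 one of $h,i,j$ is greater than (resp. equal to) the sum of the other two. It is assumed that $\theta_0>\theta_1>\dots>\theta_d$. **Clique and Terwilliger algebras.** $C\subseteq X$ is a Delsarte clique: a nonempty set of mutually adjacent vertices with $|C|=1-k/\theta_d$. Fix $x\in C$. For $y\in X$, $A^*(y)$ is the diagonal matrix with $(z,z)$-entry $|X|(E_1)_{yz}$; $A^*=A^*(x)$. $E^*_i$ ($0\le i\le d$) is the diagonal projection onto $\mathrm{Span}\{\hat z:\partial(x,z)=i\}$, and $A^*=\sum_i\theta^*_iE^*_i$. $T$ is the algebra generated by $A,A^*$. For $0\le i\le d-1$, $C_i=\{y\in X:\partial(y,C)=i\}$ (these partition $X$), and $\tilde E^*_i$ is the diagonal projection onto $\mathrm{Span}\{\hat z:z\in C_i\}$. $\tilde A^*=|C|^{-1}\sum_{y\in C}A^*(y)$; $\tilde A^*=\sum_{i=0}^{d-1}\tilde\theta^*_i\tilde E^*_i$ with $\tilde\theta_i^*$ mutually distinct. $\tilde T$ is the algebra generated by $A,\tilde A^*$. A module for one of these matrix algebras means a subspace of $\mathbf V$ invariant under it. $C_i^-=C_i\cap\Gamma_i(x)$, $C_i^+=C_i\cap\Gamma_{i+1}(x)$ for $0\le i\le d-1$. **Leonard systems.** On a complex vector space $V$ of dimension $n+1$, a Leonard system of diameter $n$ is a sequence $(B;B^*;\{F_i\}_{i=0}^n;\{F^*_i\}_{i=0}^n)$ where $B,B^*\in\mathrm{End}(V)$ each have $n+1$ distinct eigenvalues, $\{F_i\}$ (resp. $\{F_i^*\}$) is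 an ordering of the primitive idempotents (spectral projections) of $B$ (resp. $B^*$), and $F_iB^*F_j$, $F^*_iBF^*_j$ are $0$ if $|i-j|>1$ and nonzero if $|i-j|=1$. Eigenvalues $\vartheta_i$, dual eigenvalues $\vartheta^*_i$ are defined by $BF_i=\vartheta_iF_i$, $B^*F_i^*=\vartheta_i^*F_i^*$. The first split sequence is the sequence of nonzero scalars $\varphi_1,\dots,\varphi_n$ such that in some basis $B$ is lower bidiagonal with diagonal $\vartheta_0,\dots,\vartheta_n$ and subdiagonal entries $1$, and $B^*$ is upper bidiagonal with diagonal $\vartheta^*_0,\dots,\vartheta_n^*$ and superdiagonal $\varphi_1,\dots,\varphi_n$. The second split sequence $\{\phi_i\}$ is the first split sequence of $(B;B^*;\{F_{n-i}\};\{F^*_i\})$. The parameter array is $(\{\vartheta_i\},\{\vartheta_i^*\},\{\varphi_i\},\{\phi_i\})$. **$q$-Racah assumption.** $q\in\mathbb C$ is nonzero, $q^2\neq1$. $(A;A^*;\{E_i\}_{i=0}^d;\{E_i^*\}_{i=0}^d)$ acts on $\mathcal M\hat x$ (the primary $T$-module, of dimension $d+1$) as a Leonard system $\Phi$ with parameter array $(\{\theta_i\},\{\theta^*_i\},\{\varphi_i\},\{\phi_i\})$. $\Gamma$ is assumed to have $q$-Racah type: there are nonzero $h,h^*,s,s^*,r_1,r_2\in\mathbb C$ (fixed) with $r_1r_2=ss^*q^{d+1}$, none of $q^i,r_1q^i,r_2q^i,s^*q^i/r_1,s^*q^i/r_2$ equal to $1$ for $1\le i\le d$, neither of $sq^i,s^*q^i$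 equal to $1$ for $2\le i\le 2d$, and $\theta_i=\theta_0+h(1-q^i)(1-sq^{i+1})q^{-i}$, $\theta^*_i=\theta^*_0+h^*(1-q^i)(1-s^*q^{i+1})q^{-i}$ ($0\le i\le d$), $\varphi_i=hh^*q^{1-2i}(1-q^i)(1-q^{i-d-1})(1-r_1q^i)(1-r_2q^i)$, $\phi_i=hh^*q^{1-2i}(1-q^i)(1-q^{i-d-1})(r_1-s^*q^i)(r_2-s^*q^i)/s^*$ ($1\le i\le d$). *)

theory Defs
  imports "HOL-Analysis.Analysis"
begin

text \<open>
  A graph is given by its adjacency relation on a finite type, whose universe is the vertex set.
  On matrices, \<open>**\<close> is the matrix product, whereas \<open>*\<close> is the entrywise product.
\<close>


section \<open>Graphs\<close>

definition simple_graph :: "('v \<Rightarrow> 'v \<Rightarrow> bool) \<Rightarrow> bool" where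
  "simple_graph adj \<longleftrightarrow> symp adj \<and> irreflp adj"

definition connected_graph :: "('v \<Rightarrow> 'v \<Rightarrow> bool) \<Rightarrow> bool" where
  "connected_graph adj \<longleftrightarrow> (\<forall>y z. adj\<^sup>*\<^sup>* y z)"

text \<open>The least length of a walk from \<open>y\<close> to \<open>z\<close>; only meaningful if there is one.\<close>

definition gdist :: "('v \<Rightarrow> 'v \<Rightarrow> bool) \<Rightarrow> 'v \<Rightarrow> 'v \<Rightarrow> nat" where
  "gdist adj y z = (LEAST n. (adj ^^ n) y z)"

definition gdiameter :: "('v::finite \<Rightarrow> 'v \<Rightarrow> bool) \<Rightarrow> nat" where
  "gdiameter adj = Max {gdist adj y z | y z. True}"

definition sphere_at :: "('v \<Rightarrow> 'v \<Rightarrow> bool) \<Rightarrow> nat \<Rightarrow> 'v \<Rightarrow> 'v set" where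
  "sphere_at adj i y = {z. gdist adj y z = i}"

definition distance_regular :: "('v::finite \<Rightarrow> 'v \<Rightarrow> bool) \<Rightarrow> bool" where
  "distance_regular adj \<longleftrightarrow>
     (\<forall>i j y z y' z'. gdist adj y z = gdist adj y' z' \<longrightarrow>
        card (sphere_at adj i y \<inter> sphere_at adj j z) =
        card (sphere_at adj i y' \<inter> sphere_at adj j z'))"

text \<open>The number \<open>p^h_{ij}\<close> of a distance-regular graph (\<open>h\<close> at most the diameter).\<close>

definition intersection_number :: "('v::finite \<Rightarrow> 'v \<Rightarrow> bool) \<Rightarrow> nat \<Rightarrow> nat \<Rightarrow> nat \<Rightarrow> nat" where
  "intersection_number adj h i j =
     (THE n. \<forall>y z. gdist adj y z = h \<longrightarrow> card (sphere_at adj i y \<inter> sphere_at adj j z) = n)"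

definition b_number :: "('v::finite \<Rightarrow> 'v \<Rightarrow> bool) \<Rightarrow> nat \<Rightarrow> nat" where
  "b_number adj i = intersection_number adj i 1 (i + 1)"

definition valency :: "('v::finite \<Rightarrow> 'v \<Rightarrow> bool) \<Rightarrow> nat" where
  "valency adj = b_number adj 0"


section \<open>Matrix algebras and their modules\<close>

type_synonym 'v cmat = "complex^'v^'v"

definition msmult :: "complex \<Rightarrow> 'v::finite cmat \<Rightarrow> 'v cmat"  (infixr \<open>*\<^sub>M\<close> 75) where
  "c *\<^sub>M M = (\<chi> y z. c * M $ y $ z)"

definition ones_mat :: "'v::finite cmat" where
  "ones_mat = (\<chi> y z. 1)"

definition diag_of :: "('v::finite \<Rightarrow> complex) \<Rightarrow> 'v cmat" where
  "diag_of f = (\<chi> y z. if y = z then f y else 0)"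

definition std_vec :: "'v::finite \<Rightarrow> complex^'v" where
  "std_vec y = axis y 1"

definition char_vec :: "'v::finite set \<Rightarrow> complex^'v" where
  "char_vec Y = (\<Sum>y\<in>Y. std_vec y)"

definition is_subalgebra :: "'v::finite cmat set \<Rightarrow> bool" where
  "is_subalgebra S \<longleftrightarrow>
     mat 1 \<in> S \<and>
     (\<forall>M\<in>S. \<forall>N\<in>S. M + N \<in> S) \<and>
     (\<forall>c. \<forall>M\<in>S. c *\<^sub>M M \<in> S) \<and>
     (\<forall>M\<in>S. \<forall>N\<in>S. M ** N \<in> S)"

definition alg_gen :: "'v::finite cmat set \<Rightarrow> 'v cmat set" where
  "alg_gen S = is_subalgebra hull S"

definition alg_module :: "'v::finite cmat set \<Rightarrow> (complex^'v) set \<Rightarrow> bool" where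
  "alg_module T W \<longleftrightarrow> vec.subspace W \<and> (\<forall>M\<in>T. \<forall>w\<in>W. M *v w \<in> W)"

definition irreducible_module :: "'v::finite cmat set \<Rightarrow> (complex^'v) set \<Rightarrow> bool" where
  "irreducible_module T W \<longleftrightarrow>
     alg_module T W \<and> W \<noteq> {0} \<and>
     (\<forall>U. alg_module T U \<and> U \<subseteq> W \<longrightarrow> U = {0} \<or> U = W)"

definition primitive_idempotent :: "'v::finite cmat set \<Rightarrow> 'v cmat \<Rightarrow> bool" where
  "primitive_idempotent S e \<longleftrightarrow>
     e \<in> S \<and> e \<noteq> 0 \<and> e ** e = e \<and>
     (\<forall>f\<in>S. f \<noteq> 0 \<and> f ** f = f \<and> e ** f = f \<and> f ** e = f \<longrightarrow> f = e)"

lemma is_subalgebra_alg_gen: "is_subalgebra (alg_gen S)"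
  unfolding alg_gen_def
  by (rule hull_in) (auto simp: is_subalgebra_def)

lemma alg_gen_Un:
  "alg_gen (alg_gen {A, B} \<union> alg_gen {A, D}) = alg_gen {A, B, D}"
proof
  have "alg_gen {A, B} \<subseteq> alg_gen {A, B, D}" "alg_gen {A, D} \<subseteq> alg_gen {A, B, D}"
    unfolding alg_gen_def by (rule hull_mono; auto)+
  then show "alg_gen (alg_gen {A, B} \<union> alg_gen {A, D}) \<subseteq> alg_gen {A, B, D}"
    using is_subalgebra_alg_gen[of "{A, B, D}"]
    by (metis Un_least alg_gen_def hull_minimal)
next
  have "{A, B, D} \<subseteq> alg_gen {A, B} \<union> alg_gen {A, D}"
    using hull_subset[of "{A, B}" is_subalgebra] hull_subset[of "{A, D}" is_subalgebra]
    unfolding alg_gen_def by auto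
  then show "alg_gen {A, B, D} \<subseteq> alg_gen (alg_gen {A, B} \<union> alg_gen {A, D})"
    unfolding alg_gen_def by (rule hull_mono)
qed


section \<open>The Bose--Mesner algebra and the Q-polynomial property\<close>

definition dist_matrix :: "('v::finite \<Rightarrow> 'v \<Rightarrow> bool) \<Rightarrow> nat \<Rightarrow> 'v cmat" where
  "dist_matrix adj i = (\<chi> y z. if gdist adj y z = i then 1 else 0)"

definition adj_matrix :: "('v::finite \<Rightarrow> 'v \<Rightarrow> bool) \<Rightarrow> 'v cmat" where
  "adj_matrix adj = dist_matrix adj 1"

definition bose_mesner :: "('v::finite \<Rightarrow> 'v \<Rightarrow> bool) \<Rightarrow> 'v cmat set" where
  "bose_mesner adj = alg_gen {adj_matrix adj}"

definition q_polynomial :: "nat \<Rightarrow> (nat \<Rightarrow> 'v::finite cmat) \<Rightarrow> bool" where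
  "q_polynomial d E \<longleftrightarrow>
     (\<exists>kr :: nat \<Rightarrow> nat \<Rightarrow> nat \<Rightarrow> complex.
        (\<forall>i\<le>d. \<forall>j\<le>d.
           E i * E j = (1 / of_nat CARD('v)) *\<^sub>M (\<Sum>h\<le>d. kr h i j *\<^sub>M E h)) \<and>
        (\<forall>h\<le>d. \<forall>i\<le>d. \<forall>j\<le>d.
           (h > i + j \<or> i > h + j \<or> j > h + i \<longrightarrow> kr h i j = 0) \<and>
           (h = i + j \<or> i = h + j \<or> j = h + i \<longrightarrow> kr h i j \<noteq> 0)))"


section \<open>Delsarte cliques and Terwilliger algebras\<close>

definition delsarte_clique :: "('v::finite \<Rightarrow> 'v \<Rightarrow> bool) \<Rightarrow> real \<Rightarrow> 'v set \<Rightarrow> bool" where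
  "delsarte_clique adj \<theta>min C \<longleftrightarrow>
     C \<noteq> {} \<and> (\<forall>y\<in>C. \<forall>z\<in>C. y \<noteq> z \<longrightarrow> adj y z) \<and>
     real (card C) = 1 - real (valency adj) / \<theta>min"

definition set_dist :: "('v \<Rightarrow> 'v \<Rightarrow> bool) \<Rightarrow> 'v \<Rightarrow> 'v::finite set \<Rightarrow> nat" where
  "set_dist adj y C = Min (gdist adj y ` C)"

definition layer :: "('v::finite \<Rightarrow> 'v \<Rightarrow> bool) \<Rightarrow> 'v set \<Rightarrow> nat \<Rightarrow> 'v set" where
  "layer adj C i = {y. set_dist adj y C = i}"

definition layer_minus :: "('v::finite \<Rightarrow> 'v \<Rightarrow> bool) \<Rightarrow> 'v set \<Rightarrow> 'v \<Rightarrow> nat \<Rightarrow> 'v set" where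
  "layer_minus adj C x i = layer adj C i \<inter> sphere_at adj i x"

definition layer_plus :: "('v::finite \<Rightarrow> 'v \<Rightarrow> bool) \<Rightarrow> 'v set \<Rightarrow> 'v \<Rightarrow> nat \<Rightarrow> 'v set" where
  "layer_plus adj C x i = layer adj C i \<inter> sphere_at adj (i + 1) x"

definition diag_proj :: "'v::finite set \<Rightarrow> 'v cmat" where
  "diag_proj Y = diag_of (\<lambda>z. if z \<in> Y then 1 else 0)"

definition dual_idem :: "('v::finite \<Rightarrow> 'v \<Rightarrow> bool) \<Rightarrow> 'v \<Rightarrow> nat \<Rightarrow> 'v cmat" where
  "dual_idem adj x i = diag_proj (sphere_at adj i x)"

definition dual_idem_C :: "('v::finite \<Rightarrow> 'v \<Rightarrow> bool) \<Rightarrow> 'v set \<Rightarrow> nat \<Rightarrow> 'v cmat" where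
  "dual_idem_C adj C i = diag_proj (layer adj C i)"

text \<open>The matrices \<open>A*(y)\<close> and \<open>A~*\<close>, where \<open>E1\<close> stands for the primitive idempotent \<open>E_1\<close>.\<close>

definition dual_adj :: "'v::finite cmat \<Rightarrow> 'v \<Rightarrow> 'v cmat" where
  "dual_adj E1 y = diag_of (\<lambda>z. of_nat CARD('v) * E1 $ y $ z)"

definition dual_adj_C :: "'v::finite cmat \<Rightarrow> 'v set \<Rightarrow> 'v cmat" where
  "dual_adj_C E1 C = (1 / of_nat (card C)) *\<^sub>M (\<Sum>y\<in>C. dual_adj E1 y)"

definition terw_alg :: "('v::finite \<Rightarrow> 'v \<Rightarrow> bool) \<Rightarrow> 'v cmat \<Rightarrow> 'v \<Rightarrow> 'v cmat set" where
  "terw_alg adj E1 x = alg_gen {adj_matrix adj, dual_adj E1 x}"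

definition terw_alg_C :: "('v::finite \<Rightarrow> 'v \<Rightarrow> bool) \<Rightarrow> 'v cmat \<Rightarrow> 'v set \<Rightarrow> 'v cmat set" where
  "terw_alg_C adj E1 C = alg_gen {adj_matrix adj, dual_adj_C E1 C}"

definition bold_T :: "('v::finite \<Rightarrow> 'v \<Rightarrow> bool) \<Rightarrow> 'v cmat \<Rightarrow> 'v set \<Rightarrow> 'v \<Rightarrow> 'v cmat set" where
  "bold_T adj E1 C x = alg_gen (terw_alg adj E1 x \<union> terw_alg_C adj E1 C)"

lemma bold_T_eq:
  "bold_T adj E1 C x = alg_gen {adj_matrix adj, dual_adj E1 x, dual_adj_C E1 C}"
  unfolding bold_T_def terw_alg_def terw_alg_C_def by (rule alg_gen_Un)

definition bold_W :: "('v::finite \<Rightarrow> 'v \<Rightarrow> bool) \<Rightarrow> nat \<Rightarrow> 'v set \<Rightarrow> 'v \<Rightarrow> (complex^'v) set" where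
  "bold_W adj d C x =
     vec.span ((\<lambda>i. char_vec (layer_minus adj C x i)) ` {..<d} \<union>
               (\<lambda>i. char_vec (layer_plus adj C x i)) ` {..<d})"

definition primary_module :: "('v::finite \<Rightarrow> 'v \<Rightarrow> bool) \<Rightarrow> 'v \<Rightarrow> (complex^'v) set" where
  "primary_module adj x = (\<lambda>M. M *v std_vec x) ` bose_mesner adj"


section \<open>Leonard systems\<close>

text \<open>
  The underlying vector space is a subspace \<open>V\<close> of \<open>complex^'v\<close>.  An endomorphism of \<open>V\<close> is
  represented by a matrix that leaves \<open>V\<close> invariant, and only its restriction to \<open>V\<close> matters.
\<close>

definition eigenspace_on :: "(complex^'v::finite) set \<Rightarrow> 'v cmat \<Rightarrow> complex \<Rightarrow> (complex^'v) set" where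
  "eigenspace_on V B c = {v\<in>V. B *v v = c *s v}"

text \<open>
  \<open>B\<close> has \<open>n + 1\<close> distinct eigenvalues on \<open>V\<close>, and \<open>F 0, \<dots>, F n\<close> are the corresponding spectral
  projections: \<open>F i\<close> is the identity on the \<open>i\<close>-th eigenspace and vanishes on the others.
\<close>

definition spectral_ordering ::
    "(complex^'v::finite) set \<Rightarrow> nat \<Rightarrow> 'v cmat \<Rightarrow> (nat \<Rightarrow> 'v cmat) \<Rightarrow> bool" where
  "spectral_ordering V n B F \<longleftrightarrow>
     (\<forall>v\<in>V. B *v v \<in> V) \<and>
     (\<exists>\<theta>. inj_on \<theta> {..n} \<and>
        (\<forall>i\<le>n. eigenspace_on V B (\<theta> i) \<noteq> {0}) \<and>
        (\<forall>i\<le>n. \<forall>j\<le>n. \<forall>v\<in>eigenspace_on V B (\<theta> j). F i *v v = (if i = j then v else 0)))"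

text \<open>\<open>F_i B F_j\<close> vanishes on \<open>V\<close> for \<open>|i - j| > 1\<close>, and does not for \<open>|i - j| = 1\<close>.\<close>

definition irred_tridiagonal ::
    "(complex^'v::finite) set \<Rightarrow> nat \<Rightarrow> 'v cmat \<Rightarrow> (nat \<Rightarrow> 'v cmat) \<Rightarrow> bool" where
  "irred_tridiagonal V n B F \<longleftrightarrow>
     (\<forall>i\<le>n. \<forall>j\<le>n.
        (\<bar>int i - int j\<bar> > 1 \<longrightarrow> (\<forall>v\<in>V. (F i ** B ** F j) *v v = 0)) \<and>
        (\<bar>int i - int j\<bar> = 1 \<longrightarrow> (\<exists>v\<in>V. (F i ** B ** F j) *v v \<noteq> 0)))"

definition leonard_system ::
    "(complex^'v::finite) set \<Rightarrow> nat \<Rightarrow> 'v cmat \<Rightarrow> 'v cmat \<Rightarrow> (nat \<Rightarrow> 'v cmat) \<Rightarrow>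
     (nat \<Rightarrow> 'v cmat) \<Rightarrow> bool" where
  "leonard_system V n B Bs F Fs \<longleftrightarrow>
     vec.subspace V \<and> vec.dim V = n + 1 \<and>
     spectral_ordering V n B F \<and> spectral_ordering V n Bs Fs \<and>
     irred_tridiagonal V n Bs F \<and> irred_tridiagonal V n B Fs"

definition eigenvalue_sequence ::
    "(complex^'v::finite) set \<Rightarrow> nat \<Rightarrow> 'v cmat \<Rightarrow> (nat \<Rightarrow> 'v cmat) \<Rightarrow> (nat \<Rightarrow> complex) \<Rightarrow> bool" where
  "eigenvalue_sequence V n B F \<theta> \<longleftrightarrow>
     (\<forall>i\<le>n. \<forall>v\<in>V. (B ** F i) *v v = \<theta> i *s (F i *v v))"

text \<open>
  \<open>u 0, \<dots>, u n\<close> is the basis in which \<open>B\<close> is lower and \<open>Bs\<close> upper bidiagonal; the \<open>i\<close>-th column of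
  the matrix representing a map consists of the coordinates of the image of \<open>u i\<close>.
\<close>

definition first_split_sequence ::
    "(complex^'v::finite) set \<Rightarrow> nat \<Rightarrow> 'v cmat \<Rightarrow> 'v cmat \<Rightarrow> (nat \<Rightarrow> 'v cmat) \<Rightarrow>
     (nat \<Rightarrow> 'v cmat) \<Rightarrow> (nat \<Rightarrow> complex) \<Rightarrow> bool" where
  "first_split_sequence V n B Bs F Fs \<phi> \<longleftrightarrow>
     (\<forall>i\<in>{1..n}. \<phi> i \<noteq> 0) \<and>
     (\<exists>\<theta> \<theta>s u.
        eigenvalue_sequence V n B F \<theta> \<and> eigenvalue_sequence V n Bs Fs \<theta>s \<and>
        inj_on u {..n} \<and> vec.independent (u ` {..n}) \<and> vec.span (u ` {..n}) = V \<and>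
        (\<forall>i<n. B *v u i = \<theta> i *s u i + u (i + 1)) \<and>
        B *v u n = \<theta> n *s u n \<and>
        Bs *v u 0 = \<theta>s 0 *s u 0 \<and>
        (\<forall>i\<in>{1..n}. Bs *v u i = \<theta>s i *s u i + \<phi> i *s u (i - 1)))"

definition second_split_sequence ::
    "(complex^'v::finite) set \<Rightarrow> nat \<Rightarrow> 'v cmat \<Rightarrow> 'v cmat \<Rightarrow> (nat \<Rightarrow> 'v cmat) \<Rightarrow>
     (nat \<Rightarrow> 'v cmat) \<Rightarrow> (nat \<Rightarrow> complex) \<Rightarrow> bool" where
  "second_split_sequence V n B Bs F Fs \<phi> \<longleftrightarrow>
     first_split_sequence V n B Bs (\<lambda>i. F (n - i)) Fs \<phi>"

definition parameter_array ::
    "(complex^'v::finite) set \<Rightarrow> nat \<Rightarrow> 'v cmat \<Rightarrow> 'v cmat \<Rightarrow> (nat \<Rightarrow> 'v cmat) \<Rightarrow>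
     (nat \<Rightarrow> 'v cmat) \<Rightarrow> (nat \<Rightarrow> complex) \<Rightarrow> (nat \<Rightarrow> complex) \<Rightarrow> (nat \<Rightarrow> complex) \<Rightarrow>
     (nat \<Rightarrow> complex) \<Rightarrow> bool" where
  "parameter_array V n B Bs F Fs \<theta> \<theta>s \<phi>1 \<phi>2 \<longleftrightarrow>
     eigenvalue_sequence V n B F \<theta> \<and> eigenvalue_sequence V n Bs Fs \<theta>s \<and>
     first_split_sequence V n B Bs F Fs \<phi>1 \<and> second_split_sequence V n B Bs F Fs \<phi>2"

definition q_racah ::
    "nat \<Rightarrow> complex \<Rightarrow> complex \<Rightarrow> complex \<Rightarrow> complex \<Rightarrow> complex \<Rightarrow> complex \<Rightarrow> complex \<Rightarrow>
     (nat \<Rightarrow> complex) \<Rightarrow> (nat \<Rightarrow> complex) \<Rightarrow> (nat \<Rightarrow> complex) \<Rightarrow> (nat \<Rightarrow> complex) \<Rightarrow> bool" where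
  "q_racah d q h hs s ss r1 r2 \<theta> \<theta>s \<phi>1 \<phi>2 \<longleftrightarrow>
     h \<noteq> 0 \<and> hs \<noteq> 0 \<and> s \<noteq> 0 \<and> ss \<noteq> 0 \<and> r1 \<noteq> 0 \<and> r2 \<noteq> 0 \<and>
     r1 * r2 = s * ss * q ^ (d + 1) \<and>
     (\<forall>i\<in>{1..d}. q ^ i \<noteq> 1 \<and> r1 * q ^ i \<noteq> 1 \<and> r2 * q ^ i \<noteq> 1 \<and>
        ss * q ^ i / r1 \<noteq> 1 \<and> ss * q ^ i / r2 \<noteq> 1) \<and>
     (\<forall>i\<in>{2..2 * d}. s * q ^ i \<noteq> 1 \<and> ss * q ^ i \<noteq> 1) \<and>
     (\<forall>i\<le>d. \<theta> i = \<theta> 0 + h * (1 - q ^ i) * (1 - s * q ^ (i + 1)) * q powi (- int i)) \<and>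
     (\<forall>i\<le>d. \<theta>s i = \<theta>s 0 + hs * (1 - q ^ i) * (1 - ss * q ^ (i + 1)) * q powi (- int i)) \<and>
     (\<forall>i\<in>{1..d}. \<phi>1 i = h * hs * q powi (1 - 2 * int i) * (1 - q ^ i) *
        (1 - q powi (int i - int d - 1)) * (1 - r1 * q ^ i) * (1 - r2 * q ^ i)) \<and>
     (\<forall>i\<in>{1..d}. \<phi>2 i = h * hs * q powi (1 - 2 * int i) * (1 - q ^ i) *
        (1 - q powi (int i - int d - 1)) * (r1 - ss * q ^ i) * (r2 - ss * q ^ i) / ss)"

end

theory Submission
  imports Defs
begin

text \<open>
  Equality in the Delsarte bound means that \<open>E\<^sub>d\<close> annihilates the characteristic vector of \<open>C\<close>
  (\<open>delsarte_clique_killed\<close>).  Since \<open>E\<^sub>d\<close> has entries depending on the distance only, and an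
  eigenvector of the three-term recurrence has no two consecutive zeros, this equation determines how
  many vertices of \<open>C\<close> lie at distance \<open>i\<close> from a vertex of the \<open>i\<close>-th layer \<open>C\<^sub>i\<close>, and it excludes
  \<open>C\<^sub>d\<close> (\<open>near_cong\<close>, \<open>set_dist_less_gdiameter\<close>).  Call the nonempty sets among the \<open>C\<^sub>i\<^sup>-\<close> and
  \<open>C\<^sub>i\<^sup>+\<close> cells.  They partition the vertices, so that \<open>\<^bold>W\<close> consists of the vectors that are constant
  on the cells (\<open>bold_W_eq\<close>).

  Let \<open>\<M>\<close> be the algebra spanned by the distance matrices.  The layers are in \<open>\<M> C\<close> because
  \<open>A\<^sub>i C\<close> is a combination of the layers \<open>i - 1\<close> and \<open>i\<close>, the latter with nonzero coefficient.  In the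
  sequence \<open>C\<^sub>0\<^sup>-, C\<^sub>0\<^sup>+, C\<^sub>1\<^sup>-, C\<^sub>1\<^sup>+, \<dots>\<close> any two consecutive sets make up a layer or a sphere around \<open>x\<close>.
  Hence \<open>\<^bold>W = \<M> x + \<M> C\<close> (\<open>bold_W_eq_orbit_sum\<close>), which is visibly invariant under \<open>A\<close>;
  invariance under the two diagonal generators is clear.

  For irreducibility (\<open>irreducible\<close>), the eigenvalues of \<open>A*\<close> separate the spheres around \<open>x\<close>, and
  those of the dual adjacency matrix of \<open>C\<close> separate the layers.  So the projections onto the cells
  belong to the algebra, and a nonzero submodule contains the characteristic vector of some cell.
  Applying \<open>A\<close> and projecting yields the vectors of all cells joined to it by an edge, because the
  entries involved count edges and cannot cancel.  As the graph is connected, all cells are reached.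
\<close>


section \<open>Distances in a connected graph\<close>

locale connected_simple_graph =
  fixes adj :: "'v::finite \<Rightarrow> 'v \<Rightarrow> bool"
  assumes simple: "simple_graph adj"
    and connected: "connected_graph adj"
begin

lemma adj_sym: "adj y z \<Longrightarrow> adj z y"
  using simple by (auto simp: simple_graph_def dest: sympD)

lemma adj_irrefl: "\<not> adj y y"
  using simple by (auto simp: simple_graph_def dest: irreflpD)

lemma gdist_walk: "(adj ^^ gdist adj y z) y z"
proof -
  have "adj\<^sup>*\<^sup>* y z"
    using connected by (simp add: connected_graph_def)
  then show ?thesis
    unfolding gdist_def by (metis LeastI rtranclp_power)
qed

lemma gdist_le: "(adj ^^ n) y z \<Longrightarrow> gdist adj y z \<le> n"
  unfolding gdist_def by (rule Least_le)

lemma gdist_commute: "gdist adj y z = gdist adj z y"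
proof -
  have rev: "(adj ^^ n) z y" if "(adj ^^ n) y z" for n y z
    using that
  proof (induction n arbitrary: z)
    case (Suc n)
    then obtain w where "(adj ^^ n) y w" "adj w z" by auto
    then show ?case using Suc.IH adj_sym by (metis relpowp_Suc_I2)
  qed auto
  show ?thesis
    by (meson gdist_le gdist_walk le_antisym rev)
qed

lemma gdist_eq_0_iff: "gdist adj y z = 0 \<longleftrightarrow> y = z"
proof
  assume "gdist adj y z = 0"
  then show "y = z" using gdist_walk[of y z] by simp
next
  assume "y = z"
  then show "gdist adj y z = 0" using gdist_le[of 0 y z] by simp
qed

lemma gdist_self [simp]: "gdist adj y y = 0"
  by (simp add: gdist_eq_0_iff)

lemma gdist_adj_le: "adj y w \<Longrightarrow> gdist adj y z \<le> Suc (gdist adj w z)"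
  using gdist_walk[of w z] by (intro gdist_le) (rule relpowp_Suc_I2)

lemma gdist_eq_1_iff: "gdist adj y z = 1 \<longleftrightarrow> adj y z"
proof
  assume "gdist adj y z = 1"
  then show "adj y z" using gdist_walk[of y z] by auto
next
  assume a: "adj y z"
  then have "gdist adj y z \<le> 1" using gdist_adj_le[of y z z] by simp
  moreover have "gdist adj y z \<noteq> 0" using a adj_irrefl gdist_eq_0_iff by auto
  ultimately show "gdist adj y z = 1" by simp
qed

lemma gdist_step:
  assumes "gdist adj y z = Suc n"
  obtains w where "adj y w" "gdist adj w z = n"
proof -
  have "(adj ^^ Suc n) y z" using gdist_walk[of y z] assms by simp
  then obtain w where w: "adj y w" "(adj ^^ n) w z"
    by (metis relpowp_Suc_D2)
  then have "gdist adj w z = n"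
    using gdist_le[OF w(2)] gdist_adj_le[OF w(1), of z] assms by simp
  then show ?thesis using w that by blast
qed

lemma finite_gdists: "finite {gdist adj y z | y z. True}"
proof -
  have "{gdist adj y z | y z. True} = (\<lambda>(y, z). gdist adj y z) ` UNIV" by auto
  then show ?thesis by simp
qed

lemma gdist_le_gdiameter: "gdist adj y z \<le> gdiameter adj"
  unfolding gdiameter_def by (rule Max_ge[OF finite_gdists]) auto

lemma gdiameter_attained: "\<exists>y z. gdist adj y z = gdiameter adj"
proof -
  have "gdiameter adj \<in> {gdist adj y z | y z. True}"
    unfolding gdiameter_def by (rule Max_in[OF finite_gdists]) auto
  then obtain y z where "gdist adj y z = gdiameter adj" by auto
  then show ?thesis by blast
qed

lemma adj_matrix_nth: "adj_matrix adj $ y $ z = (if adj y z then 1 else 0)"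
  by (simp add: adj_matrix_def dist_matrix_def gdist_eq_1_iff[simplified])

lemma adj_matrix_mult_vec_nth: "(adj_matrix adj *v v) $ y = (\<Sum>w | adj y w. v $ w)"
  by (simp add: matrix_vector_mult_def adj_matrix_nth if_distrib[of "\<lambda>t. t * _"]
      sum.If_cases cong: if_cong)

lemma adj_matrix_mult_nth: "(adj_matrix adj ** M) $ y $ z = (\<Sum>w | adj y w. M $ w $ z)"
  by (simp add: matrix_matrix_mult_def adj_matrix_nth if_distrib[of "\<lambda>t. t * _"]
      sum.If_cases cong: if_cong)

end


section \<open>Eigenfunctions of the distance\<close>

lemma sum_eq_0_single_value:
  fixes g :: "nat \<Rightarrow> complex"
  assumes "finite S" "\<And>w. w \<in> S \<Longrightarrow> f w = n \<or> g (f w) = 0" "v \<in> S" "f v = n"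
    and "(\<Sum>w\<in>S. g (f w)) = 0"
  shows "g n = 0"
proof -
  have "(\<Sum>w\<in>S. g (f w)) = (\<Sum>w\<in>S. if f w = n then g n else 0)"
    using assms(2) by (intro sum.cong) auto
  also have "\<dots> = of_nat (card {w\<in>S. f w = n}) * g n"
    using assms(1) by (simp add: sum.If_cases Int_def)
  finally have "of_nat (card {w\<in>S. f w = n}) * g n = 0"
    using assms(5) by simp
  moreover have "card {w\<in>S. f w = n} \<noteq> 0"
    using assms(1,3,4) by auto
  ultimately show ?thesis by simp
qed

text \<open>
  A function \<open>g\<close> of the distance is here an eigenfunction if \<open>y \<mapsto> g (\<partial>(y, z))\<close> is an eigenvector of
  the adjacency matrix for every base vertex \<open>z\<close>.  The values of \<open>g\<close> beyond the diameter play no role.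
\<close>

definition (in connected_simple_graph) dist_eigenfunction :: "complex \<Rightarrow> (nat \<Rightarrow> complex) \<Rightarrow> bool" where
  "dist_eigenfunction t g \<longleftrightarrow>
     (\<forall>y z. (\<Sum>w | adj y w. g (gdist adj w z)) = t * g (gdist adj y z))"

context connected_simple_graph
begin

text \<open>
  The three-term recurrence, read upwards: the value at \<open>0\<close> determines an eigenfunction.
\<close>

lemma dist_eigenfunction_zero:
  assumes g: "dist_eigenfunction t g" and "g 0 = 0"
  shows "g (gdist adj y z) = 0"
proof (induction "gdist adj y z" arbitrary: y z rule: less_induct)
  case less
  show ?case
  proof (cases "gdist adj y z")
    case 0
    then show ?thesis using assms by simp
  next
    case (Suc n)
    then obtain w where w: "adj y w" "gdist adj w z = n" by (rule gdist_step)
    have "g n = 0" using less[of w z] w Suc by simp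
    then have sum0: "(\<Sum>v | adj w v. g (gdist adj v z)) = 0"
      using g w by (simp add: dist_eigenfunction_def)
    have level: "gdist adj v z = Suc n \<or> g (gdist adj v z) = 0" if "adj w v" for v
      using less[of v z] gdist_adj_le[OF adj_sym[OF that], of z] w Suc by force
    have "g (Suc n) = 0"
      by (rule sum_eq_0_single_value[OF _ _ _ _ sum0, where v=y])
        (use level Suc adj_sym[OF w(1)] in simp_all)
    then show ?thesis using Suc by simp
  qed
qed

text \<open>
  The same recurrence, read downwards: two consecutive zeros, or a zero at the diameter, force the
  value at \<open>0\<close> to vanish.
\<close>

lemma dist_eigenfunction_zero_down:
  assumes g: "dist_eigenfunction t g"
    and "gdist adj y z = n" "g n = 0"
    and "\<And>u v. gdist adj u v = Suc n \<Longrightarrow> g (Suc n) = 0"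
  shows "g 0 = 0"
  using assms(2-)
proof (induction n arbitrary: y)
  case (Suc n)
  obtain w where w: "adj y w" "gdist adj w z = n" using Suc.prems(1) by (rule gdist_step)
  have sum0: "(\<Sum>v | adj y v. g (gdist adj v z)) = 0"
    using g Suc.prems by (simp add: dist_eigenfunction_def)
  have level: "gdist adj v z = n \<or> g (gdist adj v z) = 0" if v: "adj y v" for v
  proof -
    have "gdist adj v z \<le> Suc (Suc n)" "n \<le> gdist adj v z"
      using gdist_adj_le[OF v, of z] gdist_adj_le[OF adj_sym[OF v], of z] Suc.prems(1) by auto
    then consider "gdist adj v z = n" | "gdist adj v z = Suc n" | "gdist adj v z = Suc (Suc n)"
      by linarith
    then show ?thesis using Suc.prems by cases auto
  qed
  have "g n = 0"
    by (rule sum_eq_0_single_value[OF _ _ _ _ sum0, where v=w]) (use level w in simp_all)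
  then show ?case using Suc.IH[OF w(2)] Suc.prems(2) by blast
qed auto


section \<open>Distance-invariant matrices\<close>

text \<open>
  Matrices whose entries depend only on the distance, that is, linear combinations of the distance
  matrices.  In a distance-regular graph they form an algebra that contains the Bose--Mesner algebra.
\<close>

definition dist_invariant :: "'v cmat \<Rightarrow> bool" where
  "dist_invariant M \<longleftrightarrow> (\<exists>g. \<forall>y z. M $ y $ z = g (gdist adj y z))"

lemma dist_invariant_dist_matrix: "dist_invariant (dist_matrix adj i)"
  unfolding dist_invariant_def dist_matrix_def
  by (rule exI[of _ "\<lambda>n. if n = i then 1 else 0"]) simp

lemma dist_invariant_add:
  assumes "dist_invariant M" "dist_invariant N"
  shows "dist_invariant (M + N)"
proof -
  obtain f g where "\<And>y z. M $ y $ z = f (gdist adj y z)" "\<And>y z. N $ y $ z = g (gdist adj y z)"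
    using assms by (auto simp: dist_invariant_def)
  then show ?thesis
    unfolding dist_invariant_def by (intro exI[of _ "\<lambda>n. f n + g n"]) simp
qed

lemma dist_invariant_msmult:
  assumes "dist_invariant M"
  shows "dist_invariant (c *\<^sub>M M)"
proof -
  obtain g where "\<And>y z. M $ y $ z = g (gdist adj y z)"
    using assms by (auto simp: dist_invariant_def)
  then show ?thesis
    unfolding dist_invariant_def by (intro exI[of _ "\<lambda>n. c * g n"]) (simp add: msmult_def)
qed

lemma dist_invariant_sym: "dist_invariant M \<Longrightarrow> M $ y $ z = M $ z $ y"
  unfolding dist_invariant_def using gdist_commute by metis

lemma dist_eigenfunctionI:
  assumes "adj_matrix adj ** F = t *\<^sub>M F" "\<And>y z. F $ y $ z = g (gdist adj y z)"
  shows "dist_eigenfunction t g"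
  unfolding dist_eigenfunction_def
proof (intro allI)
  fix y z
  have "(adj_matrix adj ** F) $ y $ z = t * F $ y $ z"
    using assms(1) by (simp add: msmult_def)
  then show "(\<Sum>w | adj y w. g (gdist adj w z)) = t * g (gdist adj y z)"
    by (simp add: adj_matrix_mult_nth assms(2))
qed

text \<open>
  With \<open>F y z = g (\<partial>(y, z))\<close>, both \<open>g\<close> and its complex conjugate are eigenfunctions for the same
  real eigenvalue, hence proportional.  Together with \<open>F\<^sup>2 = F\<close> this shows that the conjugate of \<open>g 0\<close>
  is \<open>\<Sum>\<^sub>z |F y z|\<^sup>2\<close>, so that \<open>g 0\<close> is positive and \<open>F\<close> is real.
\<close>

lemma real_idempotent:
  assumes inv: "dist_invariant F" and idem: "F ** F = F" and "F \<noteq> 0"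
    and eig: "adj_matrix adj ** F = complex_of_real t *\<^sub>M F"
  shows "cnj (F $ y $ z) = F $ y $ z" and "Re (F $ y $ y) > 0"
proof -
  obtain g where g: "\<And>y z. F $ y $ z = g (gdist adj y z)"
    using inv by (auto simp: dist_invariant_def)
  have eg: "dist_eigenfunction t g" using dist_eigenfunctionI[OF eig g] .
  have g0: "g 0 \<noteq> 0"
  proof
    assume "g 0 = 0"
    then have "F = 0" using dist_eigenfunction_zero[OF eg] g by (simp add: vec_eq_iff)
    then show False using \<open>F \<noteq> 0\<close> by simp
  qed
  define f where "f = (\<lambda>n. cnj (g 0) * g n - g 0 * cnj (g n))"
  have "dist_eigenfunction t f"
    unfolding dist_eigenfunction_def
  proof (intro allI)
    fix y z
    have 1: "(\<Sum>w | adj y w. g (gdist adj w z)) = t * g (gdist adj y z)"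
      using eg by (simp add: dist_eigenfunction_def)
    have 2: "(\<Sum>w | adj y w. cnj (g (gdist adj w z))) = t * cnj (g (gdist adj y z))"
      using arg_cong[OF 1, of cnj] by (simp add: cnj_sum)
    show "(\<Sum>w | adj y w. f (gdist adj w z)) = t * f (gdist adj y z)"
      by (simp add: f_def sum_subtractf 1 2 algebra_simps flip: sum_distrib_left)
  qed
  then have "f (gdist adj y z) = 0" for y z
    by (rule dist_eigenfunction_zero) (simp add: f_def)
  then have ratio: "cnj (g 0) * F $ y $ z = g 0 * cnj (F $ y $ z)" for y z
    by (simp add: f_def g)
  have diag: "cnj (g 0) = complex_of_real (\<Sum>z\<in>UNIV. (cmod (F $ y $ z))\<^sup>2)" for y
  proof -
    have "g 0 = (F ** F) $ y $ y" using idem g by simp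
    also have "\<dots> = (\<Sum>z\<in>UNIV. F $ y $ z * F $ y $ z)"
      by (simp add: matrix_matrix_mult_def dist_invariant_sym[OF inv, of _ y])
    finally have "cnj (g 0) * g 0 = (\<Sum>z\<in>UNIV. cnj (g 0) * F $ y $ z * F $ y $ z)"
      by (simp add: sum_distrib_left mult.assoc)
    also have "\<dots> = g 0 * (\<Sum>z\<in>UNIV. F $ y $ z * cnj (F $ y $ z))"
      by (simp add: ratio sum_distrib_left mult_ac)
    finally have "cnj (g 0) = (\<Sum>z\<in>UNIV. F $ y $ z * cnj (F $ y $ z))"
      using g0 by (simp add: mult.commute)
    then show ?thesis by (simp add: complex_norm_square del: of_real_power)
  qed
  have real_g0: "cnj (g 0) = g 0"
    using arg_cong[OF diag[of y], of cnj] diag[of y] by (metis complex_cnj_cnj complex_cnj_complex_of_real)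
  show "cnj (F $ y $ z) = F $ y $ z" using ratio[of y z] g0 real_g0 by simp
  have "Re (g 0) \<ge> 0" "Im (g 0) = 0"
    using diag[of y] real_g0 by (simp_all add: sum_nonneg)
  then have "Re (g 0) > 0" using g0 by (metis complex_eqI less_eq_real_def zero_complex.simps)
  then show "Re (F $ y $ y) > 0" by (simp add: g)
qed

text \<open>A positive semidefinite matrix annihilates the zeros of its quadratic form.\<close>

lemma real_idempotent_mult_eq_0:
  assumes inv: "dist_invariant F" and idem: "F ** F = F" and real: "\<And>y z. cnj (F $ y $ z) = F $ y $ z"
    and v: "\<And>y. cnj (v $ y) = v $ y" and quad: "(\<Sum>y\<in>UNIV. v $ y * (F *v v) $ y) = 0"
  shows "F *v v = 0"
proof -
  define u where "u = F *v v"
  have u: "cnj (u $ y) = u $ y" for y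
    by (simp add: u_def matrix_vector_mult_def cnj_sum real v)
  have "(\<Sum>y\<in>UNIV. u $ y * u $ y) = (\<Sum>y\<in>UNIV. \<Sum>w\<in>UNIV. v $ w * (F $ w $ y * u $ y))"
    by (simp add: u_def matrix_vector_mult_def[of F v] sum_distrib_right mult_ac
        dist_invariant_sym[OF inv])
  also have "\<dots> = (\<Sum>w\<in>UNIV. v $ w * (F *v u) $ w)"
    by (subst sum.swap) (simp add: matrix_vector_mult_def sum_distrib_left)
  also have "F *v u = u" by (simp add: u_def matrix_vector_mul_assoc idem)
  finally have "(\<Sum>y\<in>UNIV. u $ y * cnj (u $ y)) = 0"
    using quad by (simp add: u flip: u_def)
  then have "complex_of_real (\<Sum>y\<in>UNIV. (cmod (u $ y))\<^sup>2) = 0"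
    by (simp add: complex_norm_square del: of_real_power)
  then have "(\<Sum>y\<in>UNIV. (cmod (u $ y))\<^sup>2) = 0" by (metis of_real_eq_0_iff)
  then have "u = 0" by (simp add: sum_nonneg_eq_0_iff vec_eq_iff)
  then show ?thesis by (simp add: u_def)
qed

end

locale distance_regular_graph = connected_simple_graph +
  assumes dist_reg: "distance_regular adj"
begin

lemma intersection_number_eq:
  "card (sphere_at adj i y \<inter> sphere_at adj j z) = intersection_number adj (gdist adj y z) i j"
proof -
  have "\<exists>!n. \<forall>u v. gdist adj u v = gdist adj y z \<longrightarrow>
      card (sphere_at adj i u \<inter> sphere_at adj j v) = n"
    using dist_reg unfolding distance_regular_def by metis
  then show ?thesis
    unfolding intersection_number_def by (rule the1I2) auto
qed

lemma valency_eq: "card {w. adj y w} = valency adj"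
proof -
  have "sphere_at adj 1 y = {w. adj y w}"
    unfolding sphere_at_def gdist_eq_1_iff ..
  then show ?thesis
    using intersection_number_eq[of 1 y 1 y] by (simp add: valency_def b_number_def)
qed

lemma dist_invariant_mult:
  assumes "dist_invariant M" "dist_invariant N"
  shows "dist_invariant (M ** N)"
proof -
  obtain f g where f: "\<And>y z. M $ y $ z = f (gdist adj y z)" and g: "\<And>y z. N $ y $ z = g (gdist adj y z)"
    using assms by (auto simp: dist_invariant_def)
  let ?D = "{..gdiameter adj}"
  have "(M ** N) $ y $ z =
      (\<Sum>(i, j)\<in>?D \<times> ?D. of_nat (intersection_number adj (gdist adj y z) i j) * (f i * g j))" for y z
  proof -
    have "(M ** N) $ y $ z = (\<Sum>w\<in>UNIV. f (gdist adj y w) * g (gdist adj z w))"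
      by (simp add: matrix_matrix_mult_def f g gdist_commute)
    also have "\<dots> = (\<Sum>p\<in>?D \<times> ?D. \<Sum>w\<in>{w \<in> UNIV. (gdist adj y w, gdist adj z w) = p}.
        f (gdist adj y w) * g (gdist adj z w))"
      by (rule sum.group[symmetric]) (auto simp: gdist_le_gdiameter)
    also have "\<dots> = (\<Sum>(i, j)\<in>?D \<times> ?D.
        of_nat (intersection_number adj (gdist adj y z) i j) * (f i * g j))"
    proof (intro sum.cong refl, clarify)
      fix i j
      have eq: "{w \<in> UNIV. (gdist adj y w, gdist adj z w) = (i, j)} = sphere_at adj i y \<inter> sphere_at adj j z"
        by (auto simp: sphere_at_def)
      have "(\<Sum>w\<in>sphere_at adj i y \<inter> sphere_at adj j z. f (gdist adj y w) * g (gdist adj z w))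
          = (\<Sum>w\<in>sphere_at adj i y \<inter> sphere_at adj j z. f i * g j)"
        by (intro sum.cong) (auto simp: sphere_at_def)
      then show "(\<Sum>w\<in>{w \<in> UNIV. (gdist adj y w, gdist adj z w) = (i, j)}. f (gdist adj y w) * g (gdist adj z w))
          = of_nat (intersection_number adj (gdist adj y z) i j) * (f i * g j)"
        unfolding eq by (simp add: intersection_number_eq)
    qed
    finally show ?thesis .
  qed
  then show ?thesis unfolding dist_invariant_def by (intro exI) auto
qed

lemma dist_invariant_bose_mesner:
  assumes "M \<in> bose_mesner adj"
  shows "dist_invariant M"
proof -
  have "mat 1 = dist_matrix adj 0"
    by (simp add: vec_eq_iff mat_def dist_matrix_def gdist_eq_0_iff)
  then have "is_subalgebra {M. dist_invariant M}"
    using dist_invariant_dist_matrix[of 0]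
    by (simp add: is_subalgebra_def dist_invariant_add dist_invariant_msmult dist_invariant_mult)
  moreover have "{adj_matrix adj} \<subseteq> {M. dist_invariant M}"
    using dist_invariant_dist_matrix by (simp add: adj_matrix_def)
  ultimately have "bose_mesner adj \<subseteq> {M. dist_invariant M}"
    unfolding bose_mesner_def alg_gen_def by (rule hull_minimal[rotated])
  then show ?thesis using assms by blast
qed

lemma bose_mesner_subalgebra: "is_subalgebra (bose_mesner adj)"
  unfolding bose_mesner_def by (rule is_subalgebra_alg_gen)

lemma bose_mesner_commute:
  assumes "M \<in> bose_mesner adj" "N \<in> bose_mesner adj"
  shows "M ** N = N ** M"
proof -
  have "M ** N \<in> bose_mesner adj"
    using assms bose_mesner_subalgebra by (simp add: is_subalgebra_def)
  note inv = assms[THEN dist_invariant_bose_mesner] this[THEN dist_invariant_bose_mesner]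
  have "(M ** N) $ y $ z = (N ** M) $ y $ z" for y z
  proof -
    have "(M ** N) $ y $ z = (M ** N) $ z $ y" by (rule dist_invariant_sym[OF inv(3)])
    also have "\<dots> = (N ** M) $ y $ z"
      by (simp add: matrix_matrix_mult_def dist_invariant_sym[OF inv(1), of z]
          dist_invariant_sym[OF inv(2), of _ y] mult.commute)
    finally show ?thesis .
  qed
  then show ?thesis by (simp add: vec_eq_iff)
qed

lemma primitive_idempotents_orthogonal:
  assumes e: "primitive_idempotent (bose_mesner adj) e" and f: "primitive_idempotent (bose_mesner adj) f"
    and "e \<noteq> f"
  shows "e ** f = 0"
proof (rule ccontr)
  assume ef: "e ** f \<noteq> 0"
  note E = e[unfolded primitive_idempotent_def] f[unfolded primitive_idempotent_def]
  have comm: "e ** f = f ** e" using E by (intro bose_mesner_commute) auto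
  have mem: "e ** f \<in> bose_mesner adj"
    using E bose_mesner_subalgebra by (simp add: is_subalgebra_def)
  have le: "e ** (e ** f) = e ** f" "f ** (e ** f) = e ** f"
    "(e ** f) ** e = e ** f" "(e ** f) ** f = e ** f"
    using E comm by (metis matrix_mul_assoc)+
  then have "(e ** f) ** (e ** f) = e ** f" by (metis matrix_mul_assoc)
  then have "e ** f = e" "e ** f = f" using E mem ef le by metis+
  then show False using \<open>e \<noteq> f\<close> by simp
qed

end


section \<open>Cliques of Delsarte size\<close>

lemma char_vec_nth: "char_vec Y $ y = (if y \<in> Y then 1 else 0)"
proof -
  have "char_vec Y $ y = (\<Sum>z\<in>Y. if z = y then 1 else 0)"
    by (simp add: char_vec_def std_vec_def axis_def eq_commute)
  then show ?thesis by simp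
qed

lemma matrix_vector_mult_char_vec: "(M *v char_vec Y) $ y = (\<Sum>w\<in>Y. M $ y $ w)"
  by (simp add: matrix_vector_mult_def char_vec_nth if_distrib[of "\<lambda>t. _ * t"] sum.If_cases
      cong: if_cong)

context connected_simple_graph
begin

lemma set_dist_le: "w \<in> C \<Longrightarrow> set_dist adj y C \<le> gdist adj y w"
  unfolding set_dist_def by simp

lemma set_dist_attained:
  assumes "C \<noteq> {}"
  obtains w where "w \<in> C" "gdist adj y w = set_dist adj y C"
proof -
  have "set_dist adj y C \<in> gdist adj y ` C"
    unfolding set_dist_def using assms by (intro Min_in) auto
  then show ?thesis using that by auto
qed

end

locale graph_clique = connected_simple_graph +
  fixes C
  assumes clique_nonempty: "C \<noteq> {}"
    and clique_adj: "\<And>y z. y \<in> C \<Longrightarrow> z \<in> C \<Longrightarrow> y \<noteq> z \<Longrightarrow> adj y z"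
begin

lemma gdist_clique:
  assumes "w \<in> C"
  shows "gdist adj y w = set_dist adj y C \<or> gdist adj y w = Suc (set_dist adj y C)"
proof -
  obtain v where v: "v \<in> C" "gdist adj y v = set_dist adj y C"
    using clique_nonempty by (rule set_dist_attained)
  have "gdist adj y w \<le> Suc (gdist adj y v)"
  proof (cases "v = w")
    case False
    then have "adj w v" using clique_adj v assms by blast
    then show ?thesis using gdist_adj_le[of w v y] gdist_commute by metis
  qed simp
  then show ?thesis using set_dist_le[OF assms, of y] v by linarith
qed

text \<open>
  For \<open>y\<close> in the \<open>i\<close>-th layer, the number of vertices of the clique at distance \<open>i\<close> from \<open>y\<close>; the
  others are at distance \<open>i + 1\<close>.
\<close>

definition near :: "'a \<Rightarrow> nat" where
  "near y = card {w \<in> C. gdist adj y w = set_dist adj y C}"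

lemma near_le: "near y \<le> card C"
  unfolding near_def by (rule card_mono) auto

lemma near_pos: "near y > 0"
proof -
  obtain w where "w \<in> C" "gdist adj y w = set_dist adj y C"
    using clique_nonempty by (rule set_dist_attained)
  then show ?thesis unfolding near_def by (auto simp: card_gt_0_iff)
qed

lemma sum_clique:
  fixes f :: "nat \<Rightarrow> complex"
  shows "(\<Sum>w\<in>C. f (gdist adj y w)) =
    of_nat (near y) * f (set_dist adj y C) +
    (of_nat (card C) - of_nat (near y)) * f (Suc (set_dist adj y C))"
proof -
  let ?i = "set_dist adj y C"
  have "(\<Sum>w\<in>C. f (gdist adj y w)) = (\<Sum>w\<in>C. if gdist adj y w = ?i then f ?i else f (Suc ?i))"
    using gdist_clique by (intro sum.cong) force+
  also have "\<dots> = of_nat (near y) * f ?i + of_nat (card (C - {w \<in> C. gdist adj y w = ?i})) * f (Suc ?i)"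
    by (simp add: sum.If_cases near_def Int_def set_diff_eq conj_comms)
      (auto intro!: arg_cong[where f=card])
  also have "card (C - {w \<in> C. gdist adj y w = ?i}) = card C - near y"
    unfolding near_def by (rule card_Diff_subset) auto
  finally show ?thesis using near_le[of y] by (simp add: of_nat_diff)
qed

context
  fixes F t
  assumes inv: "dist_invariant F" and nonzero: "F \<noteq> 0"
    and eig: "adj_matrix adj ** F = t *\<^sub>M F"
    and kills: "F *v char_vec C = 0"
begin

text \<open>
  For \<open>y\<close> in the \<open>i\<close>-th layer, the vanishing of the \<open>y\<close>-entry is a linear equation for the number of
  vertices of the clique at distance \<open>i\<close> from \<open>y\<close>, with coefficients \<open>g i\<close> and \<open>g (i + 1)\<close>; it is
  nontrivial since an eigenfunction has no two consecutive zeros.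
\<close>

lemma near_cong:
  assumes "set_dist adj y C = set_dist adj y' C"
  shows "near y = near y'"
proof (rule ccontr)
  assume neq: "near y \<noteq> near y'"
  obtain g where g: "\<And>y z. F $ y $ z = g (gdist adj y z)"
    using inv by (auto simp: dist_invariant_def)
  have eg: "dist_eigenfunction t g" using dist_eigenfunctionI[OF eig g] .
  let ?i = "set_dist adj y C"
  have zero: "of_nat (near u) * g (set_dist adj u C) +
    (of_nat (card C) - of_nat (near u)) * g (Suc (set_dist adj u C)) = 0" for u
    using arg_cong[OF kills, of "\<lambda>v. v $ u"]
    by (simp add: matrix_vector_mult_char_vec g flip: sum_clique)
  have "(of_nat (near y) - of_nat (near y')) * (g ?i - g (Suc ?i)) = 0"
    using zero[of y] zero[of y'] unfolding assms by algebra
  then have eq: "g ?i = g (Suc ?i)" using neq by simp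
  then have "of_nat (card C) * g ?i = 0"
    using zero[of y] by (simp add: algebra_simps flip: eq)
  then have gi: "g ?i = 0" using clique_nonempty by simp
  obtain w where "w \<in> C" "gdist adj y w = ?i" using clique_nonempty by (rule set_dist_attained)
  then have "g 0 = 0" using dist_eigenfunction_zero_down[OF eg] gi eq by metis
  then have "F = 0" using dist_eigenfunction_zero[OF eg] g by (simp add: vec_eq_iff)
  then show False using nonzero by simp
qed

lemma set_dist_less_gdiameter: "set_dist adj y C < gdiameter adj"
proof (rule ccontr)
  assume "\<not> ?thesis"
  then have all: "gdist adj y w = gdiameter adj" if "w \<in> C" for w
    using gdist_le_gdiameter[of y w] set_dist_le[OF that, of y] by linarith
  obtain g where g: "\<And>y z. F $ y $ z = g (gdist adj y z)"
    using inv by (auto simp: dist_invariant_def)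
  have eg: "dist_eigenfunction t g" using dist_eigenfunctionI[OF eig g] .
  have "(\<Sum>w\<in>C. g (gdist adj y w)) = 0"
    using arg_cong[OF kills, of "\<lambda>v. v $ y"] by (simp add: matrix_vector_mult_char_vec g)
  then have gD: "g (gdiameter adj) = 0"
    using clique_nonempty by (simp add: all)
  obtain w where "w \<in> C" using clique_nonempty by blast
  then have "g 0 = 0"
    using dist_eigenfunction_zero_down[OF eg all gD] gdist_le_gdiameter by (metis Suc_n_not_le_n)
  then have "F = 0" using dist_eigenfunction_zero[OF eg] g by (simp add: vec_eq_iff)
  then show False using nonzero by simp
qed

end

end

text \<open>
  Equality in the Delsarte bound: the quadratic form of the idempotent \<open>F\<close> at the characteristic
  vector of the clique is a multiple of \<open>1 + (|C| - 1) t / k\<close>.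
\<close>

lemma (in distance_regular_graph) delsarte_clique_killed:
  assumes C: "delsarte_clique adj t C" and "t \<noteq> 0" and "adj y0 z0"
    and inv: "dist_invariant F" and idem: "F ** F = F" and "F \<noteq> 0"
    and eig: "adj_matrix adj ** F = complex_of_real t *\<^sub>M F"
  shows "F *v char_vec C = 0"
proof (rule real_idempotent_mult_eq_0[OF inv idem])
  obtain g where g: "\<And>y z. F $ y $ z = g (gdist adj y z)"
    using inv by (auto simp: dist_invariant_def)
  show "cnj (F $ y $ z) = F $ y $ z" for y z
    by (rule real_idempotent[OF inv idem \<open>F \<noteq> 0\<close> eig])
  show "cnj (char_vec C $ y) = char_vec C $ y" for y by (simp add: char_vec_nth)
  define k where "k = valency adj"
  have k: "k \<noteq> 0"
    using valency_eq[of y0] \<open>adj y0 z0\<close> unfolding k_def by (metis card_eq_0_iff empty_iff finite mem_Collect_eq)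
  have "(\<Sum>w | adj y0 w. g (gdist adj w y0)) = t * g (gdist adj y0 y0)"
    using dist_eigenfunctionI[OF eig g] by (simp add: dist_eigenfunction_def)
  moreover have "(\<Sum>w | adj y0 w. g (gdist adj w y0)) = (\<Sum>w | adj y0 w. g 1)"
    using gdist_eq_1_iff[THEN iffD2, OF adj_sym] by (intro sum.cong) simp_all
  ultimately have g1: "of_nat k * g 1 = t * g 0" by (simp add: valency_eq k_def)
  have cC: "real (card C) = 1 - real k / t" and cl: "\<And>y z. y \<in> C \<Longrightarrow> z \<in> C \<Longrightarrow> y \<noteq> z \<Longrightarrow> adj y z"
    using C by (auto simp: delsarte_clique_def k_def)
  have row: "(\<Sum>z\<in>C. F $ y $ z) = 0" if y: "y \<in> C" for y
  proof -
    have "(\<Sum>z\<in>C. F $ y $ z) = g 0 + (\<Sum>z\<in>C - {y}. F $ y $ z)"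
      using y by (subst sum.remove[of _ y]) (auto simp: g)
    also have "(\<Sum>z\<in>C - {y}. F $ y $ z) = (\<Sum>z\<in>C - {y}. g 1)"
      using gdist_eq_1_iff[THEN iffD2, OF cl[OF y]] by (intro sum.cong) (auto simp: g)
    also have "\<dots> = (of_nat (card C) - 1) * g 1"
    proof -
      have "card C \<ge> 1" using y by (metis One_nat_def Suc_leI card_gt_0_iff empty_iff finite)
      then show ?thesis using y by (simp add: of_nat_diff)
    qed
    also have "of_nat (card C) - 1 = - (of_nat k / complex_of_real t)"
      using arg_cong[OF cC, of complex_of_real] by simp
    also have "g 0 + - (of_nat k / complex_of_real t) * g 1 = 0"
      using g1 \<open>t \<noteq> 0\<close> by (simp add: field_simps)
    finally show ?thesis .
  qed
  show "(\<Sum>y\<in>UNIV. char_vec C $ y * (F *v char_vec C) $ y) = 0"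
    by (rule sum.neutral) (auto simp: char_vec_nth matrix_vector_mult_char_vec row)
qed



section \<open>The cells of a completely regular clique\<close>

lemma msmult_mult_vec: "(c *\<^sub>M M) *v v = c *s (M *v v)"
  by (simp add: vec_eq_iff msmult_def matrix_vector_mult_def sum_distrib_left mult.assoc)

lemma matrix_vector_mult_std_vec: "(M *v std_vec x) $ y = M $ y $ x"
  by (simp add: matrix_vector_mult_def std_vec_def axis_def if_distrib[of "\<lambda>t. _ * t"] cong: if_cong)

text \<open>
  Complete regularity of the clique enters only through these two consequences of
  \<open>E\<^sub>d C = 0\<close>.
\<close>

locale completely_regular_clique = distance_regular_graph + graph_clique +
  assumes near_eq: "set_dist adj y C = set_dist adj y' C \<Longrightarrow> near y = near y'"
    and set_dist_less: "set_dist adj y C < gdiameter adj"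
  fixes x
  assumes x_in: "x \<in> C"
begin

lemma gdist_base: "gdist adj x y = set_dist adj y C \<or> gdist adj x y = Suc (set_dist adj y C)"
  using gdist_clique[OF x_in, of y] by (simp add: gdist_commute)

text \<open>
  The cell of \<open>y\<close>: the vertices that have the same distances to \<open>C\<close> and to \<open>x\<close> as \<open>y\<close>.  The cells are
  the nonempty sets among the \<open>C\<^sub>i\<^sup>-\<close> and \<open>C\<^sub>i\<^sup>+\<close>.
\<close>

definition cell :: "'a \<Rightarrow> 'a set" where
  "cell y = {z. gdist adj x z = gdist adj x y} \<inter> {z. set_dist adj z C = set_dist adj y C}"

lemma layer_minus_eq_cell: "y \<in> layer_minus adj C x i \<Longrightarrow> layer_minus adj C x i = cell y"
  and layer_plus_eq_cell: "y \<in> layer_plus adj C x i \<Longrightarrow> layer_plus adj C x i = cell y"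
  by (auto simp: layer_minus_def layer_plus_def layer_def sphere_at_def cell_def)

lemma bold_W_eq:
  "bold_W adj (gdiameter adj) C x = {w. \<forall>y. \<forall>z\<in>cell y. w $ z = w $ y}"
proof
  let ?R = "{w :: complex^'a. \<forall>y. \<forall>z\<in>cell y. w $ z = w $ y}"
  have "vec.subspace ?R" by (auto simp: vec.subspace_def)
  then show "bold_W adj (gdiameter adj) C x \<subseteq> ?R"
    unfolding bold_W_def
    by (intro vec.span_minimal)
      (auto simp: char_vec_nth layer_minus_def layer_plus_def layer_def sphere_at_def cell_def)
next
  show "{w. \<forall>y. \<forall>z\<in>cell y. w $ z = w $ y} \<subseteq> bold_W adj (gdiameter adj) C x"
  proof clarify
    fix w :: "complex^'a"
    assume w: "\<forall>y. \<forall>z\<in>cell y. w $ z = w $ y"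
    let ?m = "layer_minus adj C x" and ?p = "layer_plus adj C x"
    \<comment> \<open>If the set is empty, the coefficient is unspecified and multiplies the zero vector.\<close>
    define a where "a i = w $ (SOME y. y \<in> ?m i)" for i
    define b where "b i = w $ (SOME y. y \<in> ?p i)" for i
    have a: "a i = w $ y" if "y \<in> ?m i" for i y
      using w layer_minus_eq_cell[OF that] someI[of "\<lambda>y. y \<in> ?m i", OF that] by (simp add: a_def)
    have b: "b i = w $ y" if "y \<in> ?p i" for i y
      using w layer_plus_eq_cell[OF that] someI[of "\<lambda>y. y \<in> ?p i", OF that] by (simp add: b_def)
    have "w $ y = (\<Sum>i<gdiameter adj. a i *s char_vec (?m i) + b i *s char_vec (?p i)) $ y" for y
    proof -
      let ?i = "set_dist adj y C"
      have "(\<Sum>i<gdiameter adj. a i *s char_vec (?m i) + b i *s char_vec (?p i)) $ y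
          = (\<Sum>i<gdiameter adj. if i = ?i then w $ y else 0)"
        unfolding sum_component
      proof (intro sum.cong refl)
        fix i
        show "(a i *s char_vec (?m i) + b i *s char_vec (?p i)) $ y = (if i = ?i then w $ y else 0)"
          using gdist_base[of y] a[of y i] b[of y i]
          by (auto simp: char_vec_nth layer_minus_def layer_plus_def layer_def sphere_at_def)
      qed
      then show ?thesis using set_dist_less[of y] by simp
    qed
    then have "w = (\<Sum>i<gdiameter adj. a i *s char_vec (?m i) + b i *s char_vec (?p i))"
      by (simp add: vec_eq_iff)
    also have "\<dots> \<in> bold_W adj (gdiameter adj) C x"
      unfolding bold_W_def
      by (intro vec.span_sum vec.span_add vec.span_scale vec.span_base) auto
    finally show "w \<in> bold_W adj (gdiameter adj) C x" .
  qed
qed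

text \<open>The subspace \<open>\<M> x + \<M> C\<close>, where \<open>\<M>\<close> consists of the distance-invariant matrices.\<close>

definition orbit_sum :: "(complex^'a) set" where
  "orbit_sum = {M *v std_vec x + N *v char_vec C | M N. dist_invariant M \<and> dist_invariant N}"

lemma dist_invariant_0: "dist_invariant 0"
  unfolding dist_invariant_def by (rule exI[of _ "\<lambda>_. 0"]) simp

lemma orbit_sum_memI1: "dist_invariant M \<Longrightarrow> M *v std_vec x \<in> orbit_sum"
  unfolding orbit_sum_def using dist_invariant_0 by force

lemma orbit_sum_memI2: "dist_invariant N \<Longrightarrow> N *v char_vec C \<in> orbit_sum"
  unfolding orbit_sum_def using dist_invariant_0 by force

lemma orbit_sum_subspace: "vec.subspace orbit_sum"
proof (rule vec.subspaceI)
  show "0 \<in> orbit_sum" using orbit_sum_memI1[OF dist_invariant_0] by simp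
next
  fix u v assume "u \<in> orbit_sum" "v \<in> orbit_sum"
  then obtain M N M' N' where
    "u = M *v std_vec x + N *v char_vec C" "dist_invariant M" "dist_invariant N"
    "v = M' *v std_vec x + N' *v char_vec C" "dist_invariant M'" "dist_invariant N'"
    unfolding orbit_sum_def by blast
  then have "u + v = (M + M') *v std_vec x + (N + N') *v char_vec C"
      "dist_invariant (M + M')" "dist_invariant (N + N')"
    by (simp_all add: matrix_vector_mult_add_rdistrib dist_invariant_add)
  then show "u + v \<in> orbit_sum" unfolding orbit_sum_def by blast
next
  fix c u assume "u \<in> orbit_sum"
  then obtain M N where
    "u = M *v std_vec x + N *v char_vec C" "dist_invariant M" "dist_invariant N"
    unfolding orbit_sum_def by blast
  then have "c *s u = (c *\<^sub>M M) *v std_vec x + (c *\<^sub>M N) *v char_vec C"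
      "dist_invariant (c *\<^sub>M M)" "dist_invariant (c *\<^sub>M N)"
    by (simp_all add: msmult_mult_vec dist_invariant_msmult vec.scale_right_distrib)
  then show "c *s u \<in> orbit_sum" unfolding orbit_sum_def by blast
qed

lemma orbit_sum_adj:
  assumes "u \<in> orbit_sum"
  shows "adj_matrix adj *v u \<in> orbit_sum"
proof -
  obtain M N where
    u: "u = M *v std_vec x + N *v char_vec C" "dist_invariant M" "dist_invariant N"
    using assms unfolding orbit_sum_def by blast
  have "dist_invariant (adj_matrix adj ** M)" "dist_invariant (adj_matrix adj ** N)"
    using u dist_invariant_dist_matrix by (simp_all add: dist_invariant_mult adj_matrix_def)
  moreover have "adj_matrix adj *v u =
      (adj_matrix adj ** M) *v std_vec x + (adj_matrix adj ** N) *v char_vec C"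
    by (simp add: u matrix_vector_right_distrib matrix_vector_mul_assoc)
  ultimately show ?thesis unfolding orbit_sum_def by blast
qed

lemma dist_matrix_char_vec_nth:
  "(dist_matrix adj i *v char_vec C) $ y =
    (if set_dist adj y C = i then of_nat (near y)
     else if Suc (set_dist adj y C) = i then of_nat (card C) - of_nat (near y) else 0)"
  using sum_clique[of "\<lambda>n. if n = i then 1 else 0" y]
  by (simp add: matrix_vector_mult_char_vec dist_matrix_def)

text \<open>
  The \<open>i\<close>-th distance matrix sends \<open>C\<close> to a combination of the layers \<open>i\<close> and \<open>i - 1\<close> in which the
  \<open>i\<close>-th layer has the nonzero coefficient \<open>near y\<close>.
\<close>

lemma char_vec_layer:
  obtains N where "dist_invariant N" "N *v char_vec C = char_vec (layer adj C i)"
proof -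
  \<comment> \<open>If the layer is empty, the value is that of an unspecified vertex; it is nonzero in any case.\<close>
  define \<eta> where "\<eta> j = near (SOME y. y \<in> layer adj C j)" for j
  have \<eta>: "near y = \<eta> (set_dist adj y C)" for y
  proof -
    have "(SOME z. z \<in> layer adj C (set_dist adj y C)) \<in> layer adj C (set_dist adj y C)"
      by (rule someI[of _ y]) (simp add: layer_def)
    then show ?thesis unfolding \<eta>_def by (intro near_eq) (simp add: layer_def)
  qed
  have \<eta>_nz: "complex_of_nat (\<eta> j) \<noteq> 0" for j
    using near_pos by (simp add: \<eta>_def)
  have "\<exists>N. dist_invariant N \<and> N *v char_vec C = char_vec (layer adj C i)"
  proof (induction i)
    case 0
    let ?N = "(1 / of_nat (\<eta> 0)) *\<^sub>M dist_matrix adj 0"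
    have "?N *v char_vec C = char_vec (layer adj C 0)"
      using \<eta>_nz[of 0]
      by (auto simp: vec_eq_iff msmult_mult_vec dist_matrix_char_vec_nth char_vec_nth layer_def \<eta>)
    then show ?case using dist_invariant_msmult[OF dist_invariant_dist_matrix] by blast
  next
    case (Suc i)
    then obtain N where N: "dist_invariant N" "N *v char_vec C = char_vec (layer adj C i)" by blast
    let ?N = "(1 / of_nat (\<eta> (Suc i))) *\<^sub>M
      (dist_matrix adj (Suc i) + (of_nat (\<eta> i) - of_nat (card C)) *\<^sub>M N)"
    have "?N *v char_vec C = char_vec (layer adj C (Suc i))"
      using \<eta>_nz[of "Suc i"]
      by (auto simp: vec_eq_iff msmult_mult_vec matrix_vector_mult_add_rdistrib N(2)
          dist_matrix_char_vec_nth char_vec_nth layer_def \<eta> diff_divide_distrib)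
    moreover have "dist_invariant ?N"
      using N by (intro dist_invariant_msmult dist_invariant_add dist_invariant_dist_matrix)
    ultimately show ?case by blast
  qed
  then show ?thesis using that by blast
qed

text \<open>
  The chain \<open>C\<^sub>0\<^sup>-, C\<^sub>0\<^sup>+, C\<^sub>1\<^sup>-, C\<^sub>1\<^sup>+, \<dots>\<close> is unwound from its beginning: two neighbours in it make up
  alternately a layer and a sphere around \<open>x\<close>.
\<close>

lemma char_vec_cells_in_orbit_sum:
  "char_vec (layer_minus adj C x i) \<in> orbit_sum \<and> char_vec (layer_plus adj C x i) \<in> orbit_sum"
proof -
  have layer: "char_vec (layer adj C i) \<in> orbit_sum" for i
    using char_vec_layer orbit_sum_memI2 by metis
  have sphere: "char_vec (sphere_at adj i x) \<in> orbit_sum" for i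
  proof -
    have "dist_matrix adj i *v std_vec x = char_vec (sphere_at adj i x)"
      by (simp add: vec_eq_iff matrix_vector_mult_std_vec dist_matrix_def char_vec_nth sphere_at_def
          gdist_commute)
    then show ?thesis using orbit_sum_memI1[OF dist_invariant_dist_matrix] by metis
  qed
  have plus: "char_vec (layer_plus adj C x i) \<in> orbit_sum"
    if "char_vec (layer_minus adj C x i) \<in> orbit_sum" for i
  proof -
    have "char_vec (layer_plus adj C x i) = char_vec (layer adj C i) - char_vec (layer_minus adj C x i)"
      using gdist_base
      by (auto simp: vec_eq_iff char_vec_nth layer_plus_def layer_minus_def layer_def sphere_at_def)
    then show ?thesis using that layer vec.subspace_diff[OF orbit_sum_subspace] by simp
  qed
  have "char_vec (layer_minus adj C x i) \<in> orbit_sum"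
  proof (induction i)
    case 0
    have "layer_minus adj C x 0 = sphere_at adj 0 x"
      using set_dist_le[OF x_in, of x]
      by (auto simp: layer_minus_def layer_def sphere_at_def gdist_eq_0_iff)
    then show ?case using sphere by simp
  next
    case (Suc i)
    have "char_vec (layer_minus adj C x (Suc i)) =
        char_vec (sphere_at adj (Suc i) x) - char_vec (layer_plus adj C x i)"
    proof -
      have "y \<in> layer_minus adj C x (Suc i) \<longleftrightarrow> y \<in> sphere_at adj (Suc i) x - layer_plus adj C x i"
          "y \<in> layer_plus adj C x i \<Longrightarrow> y \<in> sphere_at adj (Suc i) x" for y
        using gdist_base[of y] by (auto simp: layer_plus_def layer_minus_def layer_def sphere_at_def)
      then show ?thesis by (auto simp: vec_eq_iff char_vec_nth)
    qed
    then show ?case using plus[OF Suc] sphere vec.subspace_diff[OF orbit_sum_subspace] by simp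
  qed
  then show ?thesis using plus by blast
qed

lemma bold_W_eq_orbit_sum: "bold_W adj (gdiameter adj) C x = orbit_sum"
proof
  show "bold_W adj (gdiameter adj) C x \<subseteq> orbit_sum"
    unfolding bold_W_def using char_vec_cells_in_orbit_sum
    by (intro vec.span_minimal orbit_sum_subspace) auto
next
  show "orbit_sum \<subseteq> bold_W adj (gdiameter adj) C x"
  proof
    fix w assume "w \<in> orbit_sum"
    then obtain M N where w: "w = M *v std_vec x + N *v char_vec C"
      and inv: "dist_invariant M" "dist_invariant N"
      unfolding orbit_sum_def by blast
    obtain f g where f: "\<And>y z. M $ y $ z = f (gdist adj y z)" and g: "\<And>y z. N $ y $ z = g (gdist adj y z)"
      using inv by (auto simp: dist_invariant_def)
    have "w $ z = w $ y" if "z \<in> cell y" for y z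
    proof -
      have "gdist adj z x = gdist adj y x" and *: "set_dist adj z C = set_dist adj y C"
        using that by (auto simp: cell_def gdist_commute)
      then show ?thesis
        using near_eq[OF *]
        by (simp add: w matrix_vector_mult_std_vec matrix_vector_mult_char_vec f g sum_clique)
    qed
    then show "w \<in> bold_W adj (gdiameter adj) C x" by (simp add: bold_W_eq)
  qed
qed

end


section \<open>Irreducibility\<close>

lemma alg_module_alg_gen:
  assumes "vec.subspace W" "\<And>M w. M \<in> S \<Longrightarrow> w \<in> W \<Longrightarrow> M *v w \<in> W"
  shows "alg_module (alg_gen S) W"
proof -
  have "is_subalgebra {M. \<forall>w\<in>W. M *v w \<in> W}"
    using assms(1)
    by (simp add: is_subalgebra_def msmult_mult_vec matrix_vector_mult_add_rdistrib
        vec.subspace_add vec.subspace_scale flip: matrix_vector_mul_assoc)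
  moreover have "S \<subseteq> {M. \<forall>w\<in>W. M *v w \<in> W}" using assms(2) by blast
  ultimately have "alg_gen S \<subseteq> {M. \<forall>w\<in>W. M *v w \<in> W}"
    unfolding alg_gen_def by (rule hull_minimal[rotated])
  then show ?thesis using assms(1) by (auto simp: alg_module_def)
qed

lemma diag_of_mult_vec_nth: "(diag_of f *v v) $ y = f y * v $ y"
  by (simp add: diag_of_def matrix_vector_mult_def if_distrib[of "\<lambda>t. t * _"] cong: if_cong)

lemma diag_of_mult: "diag_of f ** diag_of g = diag_of (\<lambda>y. f y * g y)"
  by (simp add: diag_of_def matrix_matrix_mult_def vec_eq_iff if_distrib[of "\<lambda>t. t * _"] cong: if_cong)

text \<open>Interpolation at the finitely many values of \<open>f\<close>.\<close>

lemma diag_proj_level_set: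
  fixes f :: "'v::finite \<Rightarrow> complex"
  assumes S: "is_subalgebra S" and f: "diag_of f \<in> S"
  shows "diag_proj {y. f y = c} \<in> S"
proof -
  have "diag_of (\<lambda>y. \<Prod>b\<in>B. f y - b) \<in> S" if "finite B" for B
    using that
  proof (induction B)
    case empty
    have "diag_of (\<lambda>y. 1) = (mat 1 :: 'v cmat)" by (simp add: diag_of_def mat_def)
    then show ?case using S by (simp add: is_subalgebra_def)
  next
    case (insert b B)
    have "diag_of (\<lambda>y. f y - b) = diag_of f + (- b) *\<^sub>M mat 1"
      by (simp add: vec_eq_iff diag_of_def mat_def msmult_def)
    then have "diag_of (\<lambda>y. f y - b) \<in> S" using S f by (simp add: is_subalgebra_def)
    then have "diag_of (\<lambda>y. f y - b) ** diag_of (\<lambda>y. \<Prod>b\<in>B. f y - b) \<in> S"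
      using S insert.IH by (simp add: is_subalgebra_def)
    then show ?case using insert.hyps by (simp add: diag_of_mult)
  qed
  from this[of "range f - {c}"]
  have "(1 / (\<Prod>b\<in>range f - {c}. c - b)) *\<^sub>M diag_of (\<lambda>y. \<Prod>b\<in>range f - {c}. f y - b) \<in> S"
    using S by (simp add: is_subalgebra_def)
  also have "(1 / (\<Prod>b\<in>range f - {c}. c - b)) *\<^sub>M diag_of (\<lambda>y. \<Prod>b\<in>range f - {c}. f y - b)
      = diag_proj {y. f y = c}"
  proof -
    have "(\<Prod>b\<in>range f - {c}. c - b) \<noteq> 0" by simp
    moreover have "(\<Prod>b\<in>range f - {c}. f y - b) = 0" if "f y \<noteq> c" for y
      using that by (intro prod_zero) auto
    ultimately show ?thesis
      by (auto simp: vec_eq_iff diag_proj_def diag_of_def msmult_def)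
  qed
  finally show ?thesis .
qed

lemma (in completely_regular_clique) irreducible:
  assumes a: "inj_on a {..gdiameter adj}" and b: "inj_on b {..<gdiameter adj}"
  defines "T \<equiv> alg_gen {adj_matrix adj, diag_of (\<lambda>y. a (gdist adj x y)),
      diag_of (\<lambda>y. b (set_dist adj y C))}"
  shows "irreducible_module T (bold_W adj (gdiameter adj) C x)"
proof -
  let ?W = "bold_W adj (gdiameter adj) C x"
  let ?S = "{adj_matrix adj, diag_of (\<lambda>y. a (gdist adj x y)), diag_of (\<lambda>y. b (set_dist adj y C))}"
  have T: "is_subalgebra T" unfolding T_def by (rule is_subalgebra_alg_gen)
  have gens: "?S \<subseteq> T" unfolding T_def alg_gen_def by (rule hull_subset)
  have subW: "vec.subspace ?W" by (simp add: bold_W_eq_orbit_sum orbit_sum_subspace)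
  have module: "alg_module T ?W"
    unfolding T_def
  proof (rule alg_module_alg_gen[OF subW])
    fix M w assume M: "M \<in> ?S" and w: "w \<in> ?W"
    show "M *v w \<in> ?W"
    proof (cases "M = adj_matrix adj")
      case True
      then show ?thesis using w orbit_sum_adj by (simp add: bold_W_eq_orbit_sum)
    next
      case False
      then obtain f where M: "M = diag_of f" and f: "\<And>y z. z \<in> cell y \<Longrightarrow> f z = f y"
        using M unfolding cell_def by force
      have "(M *v w) $ z = (M *v w) $ y" if "z \<in> cell y" for y z
        using w f[OF that] that unfolding bold_W_eq M diag_of_mult_vec_nth by auto
      then show ?thesis by (simp add: bold_W_eq)
    qed
  qed
  have proj: "diag_proj (cell y) \<in> T" for y
  proof -
    have "{z. a (gdist adj x z) = a (gdist adj x y)} = {z. gdist adj x z = gdist adj x y}"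
      using gdist_le_gdiameter by (simp add: inj_on_eq_iff[OF a])
    moreover have "{z. b (set_dist adj z C) = b (set_dist adj y C)} = {z. set_dist adj z C = set_dist adj y C}"
      using set_dist_less by (simp add: inj_on_eq_iff[OF b])
    ultimately have "diag_proj {z. gdist adj x z = gdist adj x y} \<in> T"
        "diag_proj {z. set_dist adj z C = set_dist adj y C} \<in> T"
      using gens diag_proj_level_set[OF T, of "\<lambda>z. a (gdist adj x z)" "a (gdist adj x y)"]
        diag_proj_level_set[OF T, of "\<lambda>z. b (set_dist adj z C)" "b (set_dist adj y C)"] by simp_all
    then have "diag_proj {z. gdist adj x z = gdist adj x y} **
        diag_proj {z. set_dist adj z C = set_dist adj y C} \<in> T"
      using T by (simp add: is_subalgebra_def)
    also have "diag_proj {z. gdist adj x z = gdist adj x y} **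
        diag_proj {z. set_dist adj z C = set_dist adj y C} = diag_proj (cell y)"
      unfolding diag_proj_def diag_of_mult cell_def by (rule arg_cong[of _ _ diag_of]) auto
    finally show ?thesis .
  qed
  have self: "y \<in> cell y" for y by (simp add: cell_def)
  have "?W \<noteq> {0}"
  proof -
    have "char_vec (layer_minus adj C x 0) \<in> ?W"
      using char_vec_cells_in_orbit_sum by (simp add: bold_W_eq_orbit_sum)
    moreover have "char_vec (layer_minus adj C x 0) $ x = 1"
      using set_dist_le[OF x_in, of x]
      by (simp add: char_vec_nth layer_minus_def layer_def sphere_at_def)
    ultimately show ?thesis by (metis singletonD zero_index zero_neq_one)
  qed
  moreover have "U = {0} \<or> U = ?W" if U: "alg_module T U" and UW: "U \<subseteq> ?W" for U
  proof (cases "U = {0}")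
    case False
    have subU: "vec.subspace U" and TU: "\<And>M u. M \<in> T \<Longrightarrow> u \<in> U \<Longrightarrow> M *v u \<in> U"
      using U by (auto simp: alg_module_def)
    have cellU: "char_vec (cell y) \<in> U" if u: "u \<in> U" "u $ y \<noteq> 0" for u y
    proof -
      have "u $ z = u $ y" if "z \<in> cell y" for z
        using u UW that unfolding bold_W_eq by blast
      then have "diag_proj (cell y) *v u = (u $ y) *s char_vec (cell y)"
        by (simp add: vec_eq_iff diag_proj_def diag_of_mult_vec_nth char_vec_nth)
      then have "(u $ y) *s char_vec (cell y) \<in> U" using TU[OF proj u(1), of y] by simp
      then have "(1 / u $ y) *s ((u $ y) *s char_vec (cell y)) \<in> U"
        by (rule vec.subspace_scale[OF subU])
      then show ?thesis using u(2) by simp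
    qed
    obtain u where "u \<in> U" "u \<noteq> 0" using False vec.subspace_0[OF subU] by blast
    then obtain y where y: "char_vec (cell y) \<in> U" using cellU by (auto simp: vec_eq_iff)
    have all: "char_vec (cell z) \<in> U" for z
    proof -
      have "adj\<^sup>*\<^sup>* y z" using connected by (simp add: connected_graph_def)
      then show ?thesis
      proof induction
        case (step v z)
        \<comment> \<open>The entry at \<open>z\<close> counts neighbours of \<open>z\<close>, among them \<open>v\<close>.\<close>
        have "(adj_matrix adj *v char_vec (cell v)) $ z = of_nat (card ({w. adj z w} \<inter> cell v))"
          by (simp add: adj_matrix_mult_vec_nth char_vec_nth sum.If_cases)
        moreover have "v \<in> {w. adj z w} \<inter> cell v" using step.hyps adj_sym self by simp
        then have "card ({w. adj z w} \<inter> cell v) \<noteq> 0" by (metis card_0_eq empty_iff finite)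
        ultimately show ?case
          using cellU[of "adj_matrix adj *v char_vec (cell v)" z] TU[OF _ step.IH] gens by simp
      qed (rule y)
    qed
    have "char_vec {} \<in> U" using vec.subspace_0[OF subU] by (simp add: char_vec_def)
    then have "char_vec (layer_minus adj C x i) \<in> U" "char_vec (layer_plus adj C x i) \<in> U" for i
      using all layer_minus_eq_cell layer_plus_eq_cell by (metis ex_in_conv)+
    then have "?W \<subseteq> U"
      unfolding bold_W_def by (intro vec.span_minimal[OF _ subU]) auto
    then show ?thesis using UW by blast
  qed simp
  ultimately show ?thesis using module unfolding irreducible_module_def by blast
qed


section \<open>Eigenvalues of the adjacency and dual adjacency matrices\<close>

lemma sum_matrix_mult: "(\<Sum>i\<in>I. M i) ** N = (\<Sum>i\<in>I. M i ** N)"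
  for N :: "'v::finite cmat"
  by (simp add: vec_eq_iff matrix_matrix_mult_def sum_distrib_right)
    (intro allI sum.swap)

lemma msmult_mult: "(c *\<^sub>M M) ** N = c *\<^sub>M (M ** N)"
  by (simp add: vec_eq_iff msmult_def matrix_matrix_mult_def sum_distrib_left mult.assoc)

lemma sum_diag_proj:
  fixes f :: "'v::finite \<Rightarrow> nat"
  assumes "finite I" "\<And>y. f y \<in> I"
  shows "(\<Sum>i\<in>I. c i *\<^sub>M diag_proj {y. f y = i}) = diag_of (\<lambda>y. c (f y))"
proof -
  have "(\<Sum>i\<in>I. c i *\<^sub>M diag_proj {y. f y = i}) $ y $ z = diag_of (\<lambda>y. c (f y)) $ y $ z" for y z
  proof -
    have "(\<Sum>i\<in>I. c i *\<^sub>M diag_proj {y. f y = i}) $ y $ z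
        = (\<Sum>i\<in>I. if i = f y then if y = z then c i else 0 else 0)"
      unfolding sum_component by (intro sum.cong) (auto simp: msmult_def diag_proj_def diag_of_def)
    then show ?thesis using assms by (simp add: diag_of_def)
  qed
  then show ?thesis by (simp add: vec_eq_iff)
qed

lemma leonard_system_dual_eigenvalues_distinct:
  assumes L: "leonard_system V n B Bs F Fs" and ev: "eigenvalue_sequence V n Bs Fs \<theta>s"
  shows "inj_on \<theta>s {..n}"
proof -
  obtain t where inj: "inj_on t {..n}"
    and ne: "\<And>i. i \<le> n \<Longrightarrow> eigenspace_on V Bs (t i) \<noteq> {0}"
    and F: "\<And>i v. i \<le> n \<Longrightarrow> v \<in> eigenspace_on V Bs (t i) \<Longrightarrow> Fs i *v v = v"
    and V: "vec.subspace V"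
    using L unfolding leonard_system_def spectral_ordering_def by auto
  have "\<theta>s i = t i" if i: "i \<le> n" for i
  proof -
    have "0 \<in> eigenspace_on V Bs (t i)" using V by (simp add: eigenspace_on_def vec.subspace_0)
    then obtain v where v: "v \<in> eigenspace_on V Bs (t i)" "v \<noteq> 0" using ne[OF i] by blast
    then have "(Bs ** Fs i) *v v = \<theta>s i *s (Fs i *v v)"
      using ev i by (simp add: eigenvalue_sequence_def eigenspace_on_def)
    then have "t i *s v = \<theta>s i *s v"
      using v F[OF i v(1)] by (simp add: eigenspace_on_def flip: matrix_vector_mul_assoc)
    then show ?thesis using v(2) by simp
  qed
  then show ?thesis using inj by (simp add: inj_on_def)
qed

text \<open>
  The adjacency matrix has zero diagonal, whereas the diagonals of the idempotents are positive.
\<close>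

lemma (in distance_regular_graph) least_eigenvalue_negative:
  assumes "n > 0"
    and A: "adj_matrix adj = (\<Sum>i\<le>n. complex_of_real (\<theta> i) *\<^sub>M E i)"
    and diag: "\<And>i y. i \<le> n \<Longrightarrow> Re (E i $ y $ y) > 0"
    and decr: "\<And>i. i < n \<Longrightarrow> \<theta> i > \<theta> (Suc i)"
  shows "\<theta> n < (0 :: real)"
proof (rule ccontr)
  assume "\<not> \<theta> n < 0"
  have "\<theta> i \<ge> 0 \<and> (i < n \<longrightarrow> \<theta> i > 0)" if "i \<le> n" for i
    using that
  proof (induction rule: inc_induct)
    case base
    then show ?case using \<open>\<not> \<theta> n < 0\<close> by simp
  next
    case (step i)
    then show ?case using decr[of i] by auto
  qed
  then have nonneg: "\<And>i. i \<le> n \<Longrightarrow> \<theta> i \<ge> 0" and pos: "\<theta> 0 > 0"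
    using \<open>n > 0\<close> by auto
  fix y :: 'a
  have "0 = Re (adj_matrix adj $ y $ y)" by (simp add: adj_matrix_nth adj_irrefl)
  also have "\<dots> = (\<Sum>i\<le>n. \<theta> i * Re (E i $ y $ y))" by (simp add: A msmult_def)
  also have "\<dots> > 0"
    using nonneg pos diag less_imp_le[OF diag] by (intro sum_pos2[of _ 0]) auto
  finally show False by simp
qed

theorem proposition5p25:
  fixes adj :: "'v::finite \<Rightarrow> 'v \<Rightarrow> bool"
    and d :: nat
    and E :: "nat \<Rightarrow> complex^'v^'v"
    and \<theta> :: "nat \<Rightarrow> real"
    and C :: "'v set" and x :: 'v
    and \<theta>s \<theta>ts \<phi>1 \<phi>2 :: "nat \<Rightarrow> complex"
    and q h hs s ss r1 r2 :: complex
  assumes graph: "simple_graph adj" "connected_graph adj" "gdiameter adj = d" "d \<ge> 3"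
      "distance_regular adj"
    and idempotents: "bij_betw E {..d} {e. primitive_idempotent (bose_mesner adj) e}"
      "E 0 = (1 / of_nat CARD('v)) *\<^sub>M ones_mat"
      "adj_matrix adj = (\<Sum>i\<le>d. complex_of_real (\<theta> i) *\<^sub>M E i)"
    and Q_poly: "q_polynomial d E"
    and \<theta>_decreasing: "\<And>i. i < d \<Longrightarrow> \<theta> i > \<theta> (i + 1)"
    and clique: "delsarte_clique adj (\<theta> d) C" "x \<in> C"
    and dual_eigenvalues: "dual_adj (E 1) x = (\<Sum>i\<le>d. \<theta>s i *\<^sub>M dual_idem adj x i)"
    and dual_eigenvalues_C:
      "dual_adj_C (E 1) C = (\<Sum>i<d. \<theta>ts i *\<^sub>M dual_idem_C adj C i)" "inj_on \<theta>ts {..<d}"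
    and q: "q \<noteq> 0" "q ^ 2 \<noteq> 1"
    and Leonard: "leonard_system (primary_module adj x) d
        (adj_matrix adj) (dual_adj (E 1) x) E (dual_idem adj x)"
      "parameter_array (primary_module adj x) d
        (adj_matrix adj) (dual_adj (E 1) x) E (dual_idem adj x)
        (\<lambda>i. complex_of_real (\<theta> i)) \<theta>s \<phi>1 \<phi>2"
    and q_Racah: "q_racah d q h hs s ss r1 r2 (\<lambda>i. complex_of_real (\<theta> i)) \<theta>s \<phi>1 \<phi>2"
  shows "irreducible_module (bold_T adj (E 1) C x) (bold_W adj d C x)"
proof -
  interpret distance_regular_graph adj
    using graph by unfold_locales
  have EM: "primitive_idempotent (bose_mesner adj) (E i)" if "i \<le> d" for i
    using idempotents(1) that by (auto simp: bij_betw_def)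
  have orth: "E i ** E j = (if i = j then E j else 0)" if "i \<le> d" "j \<le> d" for i j
  proof (cases "i = j")
    case True
    then show ?thesis using EM[OF that(2)] by (simp add: primitive_idempotent_def)
  next
    case False
    then have "E i \<noteq> E j" using idempotents(1) that by (auto simp: bij_betw_def inj_on_def)
    then show ?thesis using False primitive_idempotents_orthogonal EM that by simp
  qed
  have inv: "dist_invariant (E i)" and nz: "E i \<noteq> 0" and idem: "E i ** E i = E i" if "i \<le> d" for i
    using EM[OF that] dist_invariant_bose_mesner by (auto simp: primitive_idempotent_def)
  have eig: "adj_matrix adj ** E j = complex_of_real (\<theta> j) *\<^sub>M E j" if j: "j \<le> d" for j
  proof -
    have "adj_matrix adj ** E j = (\<Sum>i\<le>d. complex_of_real (\<theta> i) *\<^sub>M (E i ** E j))"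
      by (simp add: idempotents(3) sum_matrix_mult msmult_mult)
    also have "\<dots> = (\<Sum>i\<le>d. if i = j then complex_of_real (\<theta> j) *\<^sub>M E j else 0)"
      using j by (intro sum.cong) (auto simp: orth msmult_def vec_eq_iff)
    finally show ?thesis using j by simp
  qed
  have \<theta>d: "\<theta> d < 0"
  proof (rule least_eigenvalue_negative[OF _ idempotents(3)])
    show "d > 0" using graph by simp
    show "Re (E i $ y $ y) > 0" if "i \<le> d" for i y
      using real_idempotent(2)[OF inv idem nz eig] that by blast
  qed (use \<theta>_decreasing in simp)
  obtain y0 z0 where "adj y0 z0"
  proof -
    obtain y z where "gdist adj y z = d" using gdiameter_attained graph by blast
    then have "gdist adj y z = Suc (d - 1)" using graph by simp
    then show ?thesis using that by (rule gdist_step)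
  qed
  then have kill: "E d *v char_vec C = 0"
    using delsarte_clique_killed[OF clique(1) _ _ inv idem nz eig] \<theta>d by simp
  interpret graph_clique adj C
    using clique(1) by unfold_locales (auto simp: delsarte_clique_def)
  interpret completely_regular_clique adj C x
  proof unfold_locales
    show "near y = near y'" if "set_dist adj y C = set_dist adj y' C" for y y'
      using near_cong[OF inv nz eig kill that] by simp
    show "set_dist adj y C < gdiameter adj" for y
      using set_dist_less_gdiameter[OF inv nz eig kill] by simp
  qed (rule clique(2))
  have "inj_on \<theta>s {..d}"
    using leonard_system_dual_eigenvalues_distinct Leonard by (auto simp: parameter_array_def)
  moreover have "dual_adj (E 1) x = diag_of (\<lambda>y. \<theta>s (gdist adj x y))"
    unfolding dual_eigenvalues dual_idem_def sphere_at_def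
    using gdist_le_gdiameter graph(3) by (intro sum_diag_proj) auto
  moreover have "dual_adj_C (E 1) C = diag_of (\<lambda>y. \<theta>ts (set_dist adj y C))"
    unfolding dual_eigenvalues_C(1) dual_idem_C_def layer_def
    using set_dist_less graph(3) by (intro sum_diag_proj) auto
  ultimately show ?thesis
    using irreducible[of \<theta>s \<theta>ts] dual_eigenvalues_C(2) graph(3) by (simp add: bold_T_eq)
qed

end
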